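(* Let $P$ be a polytope as in the context. Every weight function $w$ of $P$ has a coherent decomposition $$w \;=\; w_0+\sum_{S \text{ split of } P}\lambda_S\, w_S,$$ with real coefficients $\lambda_S$, where $w_0$ is split prime, and this decomposition is unique among all coherent decompositions of $w$.
   Context: Let $P\subset\mathbb R^{d+1}$ be a $d$-dimensional polytope with vertices $v_1,\dots,v_n$, let $V$ be the $n\times(d+1)$ matrix whose rows are the vertices, and assume the all-ones vector lies in the column span of $V$. A weight function is a vector $w\in\mathbb R^n$ (a value for each vertex). The envelope is $\mathcal E_w(P)=\{x\in\mathbb R^{d+1}: Vx\ge -w\}$. A decomposition $w=w_1+\dots+w_m$ is coherent if $\mathcal E_{w_1}(P)+\dots+\mathcal E_{w_m}(P)=\mathcal E_w(P)$ (Minkowski sum). For weight functions $w,w'$ the coherency index is $$\alpha^w_{w'}=\min_{x\in \mathrm{Vert}\,\mathcal E_w(P)}\ \max_{x'\in\mathrm{Vert}\,\mathcal E_{w'}(P)}\ \min_{v\in V_{w'}(x')}\frac{\langle v,x\rangle+w(v)}{\langle v,x'\rangle+w'(v)},$$ where $V_{w'}(x')=\{v\in\mathrm{Vert}(P):\langle v,x'\rangle\ne -w'(v)\}$. A split of $P$ is a subdivision of $P$ without new vertices with exactly two maximal cells $S_+,S_-$; its split hyperplane $H_S$ is the linear span of $S_+\cap S_-$. The split weight is $w_S(v)=|a\cdot v|$ for $v\in S_+$ and $w_S(v)=0$ for $v\in S_-$, with $a$ a normal vector of $H_S$. A weight function $w$ is split prime if $\alpha^w_{w_S}=0$ for every split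 $S$ of $P$.
   Formalization: The coefficients λ_S are required to be nonnegative, in existence and in uniqueness; with arbitrary real λ_S uniqueness fails whenever P has a split S, e.g. w = -w_S = 0 + (-1)w_S is coherent but w also has a decomposition with all λ_S ≥ 0. *)

theory Defs
  imports "HOL-Analysis.Analysis" "HOL-Library.Set_Algebras"
begin

text \<open>
  The vertices of the polytope are the rows of a matrix \<open>V\<close>; the vertex \<open>v\<^sub>i\<close> is \<open>row i V\<close>, and a
  weight function is a vector \<open>w\<close> with \<open>w $ i\<close> the weight of \<open>row i V\<close>.
\<close>

definition vertices :: "'a::real_vector set \<Rightarrow> 'a set" where
  "vertices K = {x. x extreme_point_of K}"

definition vertex_matrix :: "(real^'k) set \<Rightarrow> real^'k^'n \<Rightarrow> bool" where
  "vertex_matrix P V \<longleftrightarrow> bij_betw (\<lambda>i. row i V) UNIV (vertices P)"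

text \<open>The order on \<open>real^'n\<close> is the componentwise one.\<close>

definition envelope :: "real^'k^'n \<Rightarrow> real^'n \<Rightarrow> (real^'k) set" where
  "envelope V w = {x. V *v x \<ge> - w}"

text \<open>Addition (and hence \<open>\<Sum>\<close>) of sets is Minkowski addition.\<close>

definition coherent :: "real^'k^'n \<Rightarrow> 'i set \<Rightarrow> ('i \<Rightarrow> real^'n) \<Rightarrow> bool" where
  "coherent V I u \<longleftrightarrow> (\<Sum>i\<in>I. envelope V (u i)) = envelope V (\<Sum>i\<in>I. u i)"

text \<open>Vertices of the polytope are represented by their row indices.\<close>

definition nontight :: "real^'k^'n \<Rightarrow> real^'n \<Rightarrow> real^'k \<Rightarrow> 'n set" where
  "nontight V w x = {i. row i V \<bullet> x \<noteq> - (w $ i)}"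

definition coherency_index :: "real^'k^'n \<Rightarrow> real^'n \<Rightarrow> real^'n \<Rightarrow> real" where
  "coherency_index V w w' =
     (MIN x\<in>vertices (envelope V w). MAX x'\<in>vertices (envelope V w').
        MIN i\<in>nontight V w' x'. (row i V \<bullet> x + w $ i) / (row i V \<bullet> x' + w' $ i))"

text \<open>The empty set counts as a face, so it belongs to every nonempty complex.\<close>

definition polytopal_complex :: "'a::euclidean_space set set \<Rightarrow> bool" where
  "polytopal_complex \<Sigma> \<longleftrightarrow>
     finite \<Sigma> \<and> (\<forall>C\<in>\<Sigma>. polytope C) \<and>
     (\<forall>C\<in>\<Sigma>. \<forall>F. F face_of C \<longrightarrow> F \<in> \<Sigma>) \<and>
     (\<forall>C\<in>\<Sigma>. \<forall>D\<in>\<Sigma>. (C \<inter> D) face_of C \<and> (C \<inter> D) face_of D)"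

definition subdivision_of :: "'a::euclidean_space set set \<Rightarrow> 'a set \<Rightarrow> bool" where
  "subdivision_of \<Sigma> P \<longleftrightarrow>
     polytopal_complex \<Sigma> \<and> \<Union>\<Sigma> = P \<and> (\<forall>C\<in>\<Sigma>. vertices C \<subseteq> vertices P)"

definition maximal_cells :: "'a set set \<Rightarrow> 'a set set" where
  "maximal_cells \<Sigma> = {C\<in>\<Sigma>. \<forall>D\<in>\<Sigma>. C \<subseteq> D \<longrightarrow> D = C}"

definition splits :: "'a::euclidean_space set \<Rightarrow> 'a set set set" where
  "splits P = {S. subdivision_of S P \<and> card (maximal_cells S) = 2}"

text \<open>
  A split weight depends on which maximal cell is called \<open>S\<^sub>+\<close> and on the scaling of the normal
  vector of the split hyperplane, hence the predicate: \<open>u\<close> is a split weight of \<open>S\<close> for some such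
  choice.
\<close>

definition split_weight :: "real^'k^'n \<Rightarrow> (real^'k) set set \<Rightarrow> real^'n \<Rightarrow> bool" where
  "split_weight V S u \<longleftrightarrow>
     (\<exists>Sp Sm a. maximal_cells S = {Sp, Sm} \<and> Sp \<noteq> Sm \<and>
        a \<noteq> 0 \<and> (\<forall>x\<in>span (Sp \<inter> Sm). a \<bullet> x = 0) \<and>
        u = (\<chi> i. if row i V \<in> Sp then \<bar>a \<bullet> row i V\<bar> else 0))"

definition split_prime :: "(real^'k) set \<Rightarrow> real^'k^'n \<Rightarrow> real^'n \<Rightarrow> bool" where
  "split_prime P V w \<longleftrightarrow>
     (\<forall>S\<in>splits P. \<forall>u. split_weight V S u \<longrightarrow> coherency_index V w u = 0)"

text \<open>
  The coherent decomposition \<open>w = w0 + (\<Sum>S. lam S * wS S)\<close>: the summand \<open>w0\<close> is indexed by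
  \<^term>\<open>None\<close> and the summand of the split \<open>S\<close> by \<^term>\<open>Some S\<close>. The coefficients have to be
  nonnegative. Without this the decomposition is not unique: for a square with splits \<open>S\<close> and \<open>T\<close>
  along the two diagonals and suitably scaled weights, \<open>l = wS S + wS T\<close> is the restriction of a
  linear form (so \<open>l\<close> is split prime), and then \<open>wS S = 0 + 1 * wS S = l + (-1) * wS T\<close> are two
  coherent decompositions of \<open>wS S\<close>.
\<close>

definition split_decomposition ::
  "(real^'k) set \<Rightarrow> real^'k^'n \<Rightarrow> ((real^'k) set set \<Rightarrow> real^'n) \<Rightarrow> real^'n \<Rightarrow>
   real^'n \<Rightarrow> ((real^'k) set set \<Rightarrow> real) \<Rightarrow> bool" where
  "split_decomposition P V wS w w0 lam \<longleftrightarrow>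
     (\<forall>S\<in>splits P. lam S \<ge> 0) \<and>
     w = w0 + (\<Sum>S\<in>splits P. lam S *\<^sub>R wS S) \<and>
     coherent V (insert None (Some ` splits P)) (case_option w0 (\<lambda>S. lam S *\<^sub>R wS S))"

end

theory Submission
  imports Defs
begin

text \<open>
  Let \<open>f\<^sub>w(p) = sup {- p \<bullet> x | x. x \<in> \<E>\<^sub>w}\<close> on the cone over \<open>P\<close>. A split with normal vector \<open>a\<close> has
  split weight \<open>max 0 (a \<bullet> v)\<close>, whose function is \<open>max 0 (a \<bullet> p)\<close>. For \<open>t \<ge> 0\<close> the following are
  equivalent: \<open>t\<close> is at most the coherency index of \<open>w\<close> with respect to the split;
  \<open>w = (w - t w\<^sub>S) + t w\<^sub>S\<close> is coherent; \<open>f\<^sub>w - t max 0 (a \<bullet> p)\<close> is convex. In that case this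
  difference is the function of \<open>w - t w\<^sub>S\<close>.

  A function from which each of two different ramps can be subtracted without losing convexity also
  admits subtracting their sum: on a generic segment the two ramps bend at different points, and
  convexity on a segment is a local property. So subtracting \<open>t w\<^sub>S\<close> coherently lowers the coherency
  index of \<open>S\<close> by \<open>t\<close> and leaves those of the other splits unchanged. A coherent decomposition
  has a split prime remainder iff each coefficient is the coherency index of \<open>w\<close>.
\<close>

subsection \<open>Envelopes and ramps\<close>

definition row_cone :: "real^'k^'n \<Rightarrow> 'n set \<Rightarrow> (real^'k) set" where
  "row_cone V I = {p. \<exists>c. (\<forall>i. 0 \<le> c i) \<and> p = (\<Sum>i\<in>I. c i *\<^sub>R row i V)}"

text \<open>A split weight with normal \<open>a\<close>. The sign of \<open>a\<close> tells which
  cell is the positive one: passing to \<open>- a\<close> exchanges the two cells.\<close>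

definition ramp :: "real^'k^'n \<Rightarrow> real^'k \<Rightarrow> real^'n" where
  "ramp V a = (\<chi> i. max 0 (a \<bullet> row i V))"

text \<open>By linear programming duality this is the lower convex envelope of \<open>w\<close>, extended
  homogeneously to the cone over the polytope.\<close>

definition hull_fun :: "real^'k^'n \<Rightarrow> real^'n \<Rightarrow> real^'k \<Rightarrow> real" where
  "hull_fun V w p = (SUP x\<in>envelope V w. - (p \<bullet> x))"

text \<open>Across the hyperplane normal to \<open>a\<close>, the slope of \<^term>\<open>hull_fun V w\<close> jumps by at least \<open>t\<close> times
  the jump of the function \<open>max 0 (a \<bullet> p)\<close>.\<close>

definition bend_ge :: "real^'k^'n \<Rightarrow> real^'n \<Rightarrow> real^'k \<Rightarrow> real \<Rightarrow> bool" where
  "bend_ge V w a t \<longleftrightarrow> (\<forall>x\<in>envelope V w. \<forall>i j. 0 < a \<bullet> row i V \<longrightarrow> a \<bullet> row j V < 0 \<longrightarrow>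
     t \<le> (row i V \<bullet> x + w $ i) / (a \<bullet> row i V) + (row j V \<bullet> x + w $ j) / (- (a \<bullet> row j V)))"

text \<open>The last condition says that cutting along the hyperplane creates no new vertices.\<close>

definition split_normal :: "real^'k^'n \<Rightarrow> real^'k \<Rightarrow> bool" where
  "split_normal V a \<longleftrightarrow> (\<exists>i. 0 < a \<bullet> row i V) \<and> (\<exists>i. a \<bullet> row i V < 0) \<and>
     (\<forall>p\<in>row_cone V UNIV. a \<bullet> p = 0 \<longrightarrow> p \<in> row_cone V {i. a \<bullet> row i V = 0})"

section \<open>Cones, envelopes and the coherence of subtracting one ramp\<close>

lemma mem_envelope: "x \<in> envelope V w \<longleftrightarrow> (\<forall>i. - w $ i \<le> row i V \<bullet> x)"
  by (simp add: envelope_def less_eq_vec_def matrix_vector_mult_def row_def inner_vec_def)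

lemma ramp_nth [simp]: "ramp V a $ i = max 0 (a \<bullet> row i V)"
  by (simp add: ramp_def)

lemma row_cone_row:
  assumes "i \<in> I"
  shows "row i V \<in> row_cone V I"
proof -
  have "(\<Sum>j\<in>I. (if j = i then 1 else 0) *\<^sub>R row j V) = (\<Sum>j\<in>I. if j = i then row j V else 0)"
    by (intro sum.cong) auto
  with assms show ?thesis
    unfolding row_cone_def by (intro CollectI exI[of _ "\<lambda>j. if j = i then 1 else 0"]) auto
qed

lemma row_cone_add:
  assumes "p \<in> row_cone V I" "q \<in> row_cone V I"
  shows "p + q \<in> row_cone V I"
proof -
  obtain c d where "\<forall>i. 0 \<le> c i" "p = (\<Sum>i\<in>I. c i *\<^sub>R row i V)"
    "\<forall>i. 0 \<le> d i" "q = (\<Sum>i\<in>I. d i *\<^sub>R row i V)"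
    using assms by (auto simp: row_cone_def)
  then show ?thesis
    unfolding row_cone_def
    by (intro CollectI exI[of _ "\<lambda>i. c i + d i"]) (simp add: scaleR_add_left sum.distrib)
qed

lemma row_cone_scaleR:
  assumes "p \<in> row_cone V I" "0 \<le> s"
  shows "s *\<^sub>R p \<in> row_cone V I"
proof -
  obtain c where "\<forall>i. 0 \<le> c i" "p = (\<Sum>i\<in>I. c i *\<^sub>R row i V)"
    using assms by (auto simp: row_cone_def)
  with assms(2) show ?thesis
    unfolding row_cone_def
    by (intro CollectI exI[of _ "\<lambda>i. s * c i"]) (simp add: scaleR_sum_right)
qed

lemma convex_row_cone: "convex (row_cone V I)"
  by (simp add: convex_def row_cone_add row_cone_scaleR)

lemma envelope_add: "x \<in> envelope V u \<Longrightarrow> x' \<in> envelope V u' \<Longrightarrow> x + x' \<in> envelope V (u + u')"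
  by (auto simp: mem_envelope inner_add_right) (smt (verit, best))

lemma shift_mem_envelope_ramp:
  assumes "0 \<le> s" "s \<le> t"
  shows "- s *\<^sub>R a \<in> envelope V (t *\<^sub>R ramp V a)"
proof -
  have "s * (a \<bullet> row i V) \<le> t * max 0 (a \<bullet> row i V)" for i
  proof (cases "0 \<le> a \<bullet> row i V")
    case True
    then show ?thesis
      using assms by (simp add: mult_right_mono)
  next
    case False
    then show ?thesis
      using assms by (simp add: mult_nonneg_nonpos)
  qed
  then show ?thesis
    by (simp add: mem_envelope inner_commute)
qed

text \<open>The parameter \<open>s\<close> lies between two families of bounds; each lower bound is below each upper
  bound by \<^term>\<open>bend_ge\<close>.\<close>

lemma bend_ge_shift:
  assumes "bend_ge V w a t" "0 \<le> t" "x \<in> envelope V w"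
  obtains s where "0 \<le> s" "s \<le> t" "x + s *\<^sub>R a \<in> envelope V (w - t *\<^sub>R ramp V a)"
proof -
  \<comment> \<open>\<open>R i\<close> is the multiple of \<open>a\<close> that exhausts the slack
    of row \<open>i\<close>. The conditions on \<open>s\<close> are \<open>t - R i \<le> s\<close>
    on the positive side and \<open>s \<le> R j\<close> on the negative side.\<close>
  define R where "R i = (row i V \<bullet> x + w $ i) / \<bar>a \<bullet> row i V\<bar>" for i
  have R0: "0 \<le> R i" for i
    using assms(3) by (simp add: R_def mem_envelope) (smt (verit) divide_nonneg_nonneg)
  have RR: "t \<le> R i + R j" if "0 < a \<bullet> row i V" "a \<bullet> row j V < 0" for i j
    using assms(1,3) that by (auto simp: bend_ge_def R_def)
  \<comment> \<open>The largest \<open>s\<close> allowed by the upper bounds is taken. Including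
    \<open>t\<close> gives \<open>s \<le> t\<close> and covers an empty negative side.\<close>
  define L where "L = insert t (R ` {j. a \<bullet> row j V < 0})"
  have L: "finite L" "L \<noteq> {}"
    by (auto simp: L_def)
  define s where "s = Min L"
  have "0 \<le> s"
    using L R0 assms(2) by (simp add: s_def Min_ge_iff L_def)
  moreover have "s \<le> t"
    using L by (auto simp: s_def L_def intro: Min_le)
  moreover have "x + s *\<^sub>R a \<in> envelope V (w - t *\<^sub>R ramp V a)"
    unfolding mem_envelope
  proof
    fix i
    consider "0 < a \<bullet> row i V" | "a \<bullet> row i V = 0" | "a \<bullet> row i V < 0"
      by linarith
    then show "- (w - t *\<^sub>R ramp V a) $ i \<le> row i V \<bullet> (x + s *\<^sub>R a)"
    proof cases
      case 1
      have "s \<in> L"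
        using L by (simp add: s_def Min_in)
      then have "t \<le> R i + s"
        using RR 1 R0[of i] by (auto simp: L_def)
      then have "t * (a \<bullet> row i V) \<le> (R i + s) * (a \<bullet> row i V)"
        using 1 by simp
      also have "\<dots> = row i V \<bullet> x + w $ i + s * (a \<bullet> row i V)"
        using 1 by (simp add: R_def field_simps)
      finally show ?thesis
        using 1 by (simp add: inner_add_right inner_commute)
    next
      case 2
      then show ?thesis
        using assms(3) by (simp add: inner_add_right inner_commute mem_envelope)
    next
      case 3
      have "s \<le> R i"
        using L 3 by (auto simp: s_def L_def intro: Min_le)
      then have "s * (- (a \<bullet> row i V)) \<le> R i * (- (a \<bullet> row i V))"
        using 3 by (intro mult_right_mono) auto
      also have "\<dots> = row i V \<bullet> x + w $ i"
        using 3 by (simp add: R_def field_simps)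
      finally show ?thesis
        using 3 by (simp add: inner_add_right inner_commute)
    qed
  qed
  ultimately show ?thesis
    using that by blast
qed

lemma bend_ge_imp_envelope_sum:
  assumes "bend_ge V w a t" "0 \<le> t"
  shows "envelope V w = envelope V (w - t *\<^sub>R ramp V a) + envelope V (t *\<^sub>R ramp V a)"
proof
  show "envelope V w \<subseteq> envelope V (w - t *\<^sub>R ramp V a) + envelope V (t *\<^sub>R ramp V a)"
  proof
    fix x assume "x \<in> envelope V w"
    with assms obtain s where s: "0 \<le> s" "s \<le> t" "x + s *\<^sub>R a \<in> envelope V (w - t *\<^sub>R ramp V a)"
      by (rule bend_ge_shift)
    have "x = (x + s *\<^sub>R a) + - s *\<^sub>R a"
      by simp
    then show "x \<in> envelope V (w - t *\<^sub>R ramp V a) + envelope V (t *\<^sub>R ramp V a)"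
      using s(3) shift_mem_envelope_ramp[OF s(1,2)] set_plus_intro by metis
  qed
  show "envelope V (w - t *\<^sub>R ramp V a) + envelope V (t *\<^sub>R ramp V a) \<subseteq> envelope V w"
    by (auto simp: set_plus_def dest: envelope_add)
qed

text \<open>A row from each side combine to a point \<open>q\<close> of the hyperplane. As cutting
  creates no new vertices, \<open>q\<close> is a nonnegative combination of rows on the hyperplane,
  where the ramp weight is 0, so \<open>q \<bullet> x\<close> is nonnegative on the
  envelope.\<close>

lemma bend_ge_ramp:
  assumes "split_normal V a"
  shows "bend_ge V (t *\<^sub>R ramp V a) a t"
  unfolding bend_ge_def
proof (intro ballI allI impI)
  fix x i j
  assume x: "x \<in> envelope V (t *\<^sub>R ramp V a)" and i: "0 < a \<bullet> row i V" and j: "a \<bullet> row j V < 0"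
  define q where "q = inverse (a \<bullet> row i V) *\<^sub>R row i V + inverse (- (a \<bullet> row j V)) *\<^sub>R row j V"
  have "q \<in> row_cone V UNIV"
    unfolding q_def using i j by (intro row_cone_add row_cone_scaleR row_cone_row) auto
  moreover have "a \<bullet> q = 0"
    using i j by (simp add: q_def inner_diff_right)
  ultimately obtain c where c: "\<forall>i. 0 \<le> c i" "q = (\<Sum>i | a \<bullet> row i V = 0. c i *\<^sub>R row i V)"
    using assms unfolding split_normal_def row_cone_def by blast
  have "0 \<le> row i V \<bullet> x" if "a \<bullet> row i V = 0" for i
    using x that by (auto simp: mem_envelope dest: spec[of _ i])
  then have "0 \<le> q \<bullet> x"
    using c(1) by (auto simp: c(2) inner_sum_left intro!: sum_nonneg)
  then have "0 \<le> (row i V \<bullet> x) / (a \<bullet> row i V) + (row j V \<bullet> x) / (- (a \<bullet> row j V))"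
    by (simp add: q_def inner_diff_left divide_inverse mult.commute)
  then show "t \<le> (row i V \<bullet> x + (t *\<^sub>R ramp V a) $ i) / (a \<bullet> row i V) +
      (row j V \<bullet> x + (t *\<^sub>R ramp V a) $ j) / (- (a \<bullet> row j V))"
    using i j by (simp add: add_divide_distrib)
qed

text \<open>Converse of \<open>bend_ge_shift\<close>: row \<open>i\<close> bounds
  \<open>t - s\<close>, row \<open>j\<close> bounds \<open>s\<close>, and adding the two bounds
  eliminates \<open>s\<close>.\<close>

lemma bend_ge_shiftI:
  assumes "\<And>x. x \<in> envelope V w \<Longrightarrow> \<exists>s. x + s *\<^sub>R a \<in> envelope V (w - t *\<^sub>R ramp V a)"
  shows "bend_ge V w a t"
  unfolding bend_ge_def
proof (intro ballI allI impI)
  fix x i j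
  assume x: "x \<in> envelope V w" and i: "0 < a \<bullet> row i V" and j: "a \<bullet> row j V < 0"
  obtain s where s: "x + s *\<^sub>R a \<in> envelope V (w - t *\<^sub>R ramp V a)"
    using assms x by blast
  have "(t - s) * (a \<bullet> row i V) \<le> row i V \<bullet> x + w $ i"
    using s i by (auto simp: mem_envelope inner_add_right inner_commute algebra_simps dest!: spec[of _ i])
  then have "t - s \<le> (row i V \<bullet> x + w $ i) / (a \<bullet> row i V)"
    using i by (simp add: pos_le_divide_eq)
  moreover have "s * - (a \<bullet> row j V) \<le> row j V \<bullet> x + w $ j"
    using s j by (auto simp: mem_envelope inner_add_right inner_commute algebra_simps dest!: spec[of _ j])
  then have "s \<le> (row j V \<bullet> x + w $ j) / (- (a \<bullet> row j V))"
    using j by (subst pos_le_divide_eq) auto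
  ultimately show "t \<le> (row i V \<bullet> x + w $ i) / (a \<bullet> row i V) + (row j V \<bullet> x + w $ j) / (- (a \<bullet> row j V))"
    by linarith
qed

text \<open>The summand from the ramp can be moved along \<open>a\<close> into
  \<open>envelope V 0\<close>, whose points may be added to those of any envelope without leaving
  it.\<close>

lemma envelope_sum_imp_bend_ge:
  assumes a: "split_normal V a" and t: "0 \<le> t"
    and sum: "envelope V w \<subseteq> envelope V (w - t *\<^sub>R ramp V a) + envelope V (t *\<^sub>R ramp V a)"
  shows "bend_ge V w a t"
proof (rule bend_ge_shiftI)
  fix x assume "x \<in> envelope V w"
  then obtain x1 x2 where x: "x = x1 + x2" "x1 \<in> envelope V (w - t *\<^sub>R ramp V a)"
    "x2 \<in> envelope V (t *\<^sub>R ramp V a)"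
    using sum by (auto simp: set_plus_def)
  obtain s where "x2 + s *\<^sub>R a \<in> envelope V (t *\<^sub>R ramp V a - t *\<^sub>R ramp V a)"
    using bend_ge_shift[OF bend_ge_ramp[OF a] t x(3)] by blast
  from envelope_add[OF x(2) this] have "x + s *\<^sub>R a \<in> envelope V (w - t *\<^sub>R ramp V a)"
    by (simp add: x(1) add.assoc)
  then show "\<exists>s. x + s *\<^sub>R a \<in> envelope V (w - t *\<^sub>R ramp V a)" ..
qed

lemma sum_envelope_subset: "finite I \<Longrightarrow> (\<Sum>i\<in>I. envelope V (u i)) \<subseteq> envelope V (\<Sum>i\<in>I. u i)"
proof (induction I rule: finite_induct)
  case empty
  show ?case
    by (simp add: mem_envelope)
next
  case (insert i I)
  then show ?case
    by (auto simp: set_plus_def dest!: subsetD intro!: envelope_add)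
qed

lemma bend_ge_scaleR:
  assumes "bend_ge V w a t" "k \<noteq> 0"
  shows "bend_ge V w (k *\<^sub>R a) (t / \<bar>k\<bar>)"
  unfolding bend_ge_def
proof (intro ballI allI impI)
  fix x i j
  assume x: "x \<in> envelope V w" and i: "0 < k *\<^sub>R a \<bullet> row i V" and j: "k *\<^sub>R a \<bullet> row j V < 0"
  show "t / \<bar>k\<bar> \<le> (row i V \<bullet> x + w $ i) / (k *\<^sub>R a \<bullet> row i V) + (row j V \<bullet> x + w $ j) / - (k *\<^sub>R a \<bullet> row j V)"
  proof (cases "0 < k")
    case True
    then have "0 < a \<bullet> row i V" "a \<bullet> row j V < 0"
      using i j by (auto simp: zero_less_mult_iff mult_less_0_iff)
    then have "t \<le> (row i V \<bullet> x + w $ i) / (a \<bullet> row i V) + (row j V \<bullet> x + w $ j) / - (a \<bullet> row j V)"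
      using assms(1) x unfolding bend_ge_def by blast
    from divide_right_mono[OF this, of k] True show ?thesis
      by (simp add: add_divide_distrib diff_divide_distrib mult.commute)
  next
    case False
    then have "a \<bullet> row i V < 0" "0 < a \<bullet> row j V"
      using i j assms(2) by (auto simp: zero_less_mult_iff mult_less_0_iff)
    then have "t \<le> (row j V \<bullet> x + w $ j) / (a \<bullet> row j V) + (row i V \<bullet> x + w $ i) / - (a \<bullet> row i V)"
      using assms(1) x unfolding bend_ge_def by blast
    from divide_right_mono[OF this, of "- k"] False assms(2) show ?thesis
      by (simp add: add_divide_distrib diff_divide_distrib mult.commute)
  qed
qed

lemma split_normal_scaleR:
  assumes "split_normal V a" "k \<noteq> 0"
  shows "split_normal V (k *\<^sub>R a)"
proof -
  have "(\<exists>i. 0 < k * (a \<bullet> row i V)) \<and> (\<exists>i. k * (a \<bullet> row i V) < 0)"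
    using assms unfolding split_normal_def zero_less_mult_iff mult_less_0_iff
    by (meson linorder_neqE_linordered_idom)
  then show ?thesis
    using assms by (auto simp: split_normal_def)
qed

subsection \<open>Convexity and bends\<close>

text \<open>Weak duality: a representation of \<open>p\<close> by the rows bounds the supremum.
  Outside the cone the set may be unbounded and its real supremum meaningless, hence the recurring
  assumption on \<open>p\<close>.\<close>

lemma hull_fun_bdd_above:
  assumes "p \<in> row_cone V UNIV"
  shows "bdd_above ((\<lambda>x. - (p \<bullet> x)) ` envelope V w)"
proof -
  obtain c where c: "\<forall>i. 0 \<le> c i" "p = (\<Sum>i\<in>UNIV. c i *\<^sub>R row i V)"
    using assms by (auto simp: row_cone_def)
  have "- (p \<bullet> x) \<le> (\<Sum>i\<in>UNIV. c i * w $ i)" if "x \<in> envelope V w" for x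
  proof -
    have "(\<Sum>i\<in>UNIV. c i * - (w $ i)) \<le> (\<Sum>i\<in>UNIV. c i * (row i V \<bullet> x))"
      using that c(1) by (intro sum_mono mult_left_mono) (auto simp: mem_envelope)
    then show ?thesis
      by (simp add: c(2) inner_sum_left sum_negf)
  qed
  then show ?thesis
    by (auto intro!: bdd_aboveI2)
qed

lemma hull_fun_upper:
  "p \<in> row_cone V UNIV \<Longrightarrow> x \<in> envelope V w \<Longrightarrow> - (p \<bullet> x) \<le> hull_fun V w p"
  unfolding hull_fun_def by (intro cSUP_upper hull_fun_bdd_above)

text \<open>The functional \<open>y\<close> puts the vertices in an affine hyperplane off the
  origin, and large multiples of it lie in any given envelope. The spanning rows make the envelopes
  pointed.\<close>

locale vertex_config =
  fixes V :: "real^'k^'n" and y :: "real^'k"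
  assumes row_inner_y: "row i V \<bullet> y = 1"
    and rows_spanning: "(\<And>i. row i V \<bullet> d = 0) \<Longrightarrow> d = 0"
begin

lemma envelope_nonempty: "envelope V w \<noteq> {}"
proof -
  have "- w $ i \<le> norm w" for i
    using component_le_norm_cart[of w i] by linarith
  then have "norm w *\<^sub>R y \<in> envelope V w"
    by (simp add: mem_envelope row_inner_y)
  then show ?thesis by blast
qed

lemma hull_fun_least: "(\<And>x. x \<in> envelope V w \<Longrightarrow> - (p \<bullet> x) \<le> B) \<Longrightarrow> hull_fun V w p \<le> B"
  unfolding hull_fun_def using envelope_nonempty by (rule cSUP_least)

lemma hull_fun_row: "hull_fun V w (row i V) \<le> w $ i"
  by (rule hull_fun_least) (simp add: mem_envelope minus_le_iff)

lemma hull_fun_scaleR_le: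
  assumes "p \<in> row_cone V UNIV" "0 \<le> s"
  shows "hull_fun V w (s *\<^sub>R p) \<le> s * hull_fun V w p"
proof (rule hull_fun_least)
  fix x assume "x \<in> envelope V w"
  then have "s * - (p \<bullet> x) \<le> s * hull_fun V w p"
    using assms by (intro mult_left_mono hull_fun_upper)
  then show "- (s *\<^sub>R p \<bullet> x) \<le> s * hull_fun V w p"
    by simp
qed

lemma hull_fun_add:
  assumes "p \<in> row_cone V UNIV" "q \<in> row_cone V UNIV"
  shows "hull_fun V w (p + q) \<le> hull_fun V w p + hull_fun V w q"
proof (rule hull_fun_least)
  fix x assume "x \<in> envelope V w"
  then show "- ((p + q) \<bullet> x) \<le> hull_fun V w p + hull_fun V w q"
    using hull_fun_upper[OF assms(1)] hull_fun_upper[OF assms(2)] by (force simp: inner_add_left)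
qed

text \<open>Upper bound: the shifts by \<open>0\<close> and by \<open>- t *\<^sub>R a\<close> give
  the two branches of the maximum. Lower bound: \<open>bend_ge_shift\<close> moves each point of
  \<open>envelope V w\<close> into the other envelope, at a cost of
  \<open>s * (a \<bullet> p)\<close>.\<close>

lemma hull_fun_diff_ramp:
  assumes "bend_ge V w a t" "0 \<le> t" and p: "p \<in> row_cone V UNIV"
  shows "hull_fun V (w - t *\<^sub>R ramp V a) p = hull_fun V w p - t * max 0 (a \<bullet> p)"
proof (rule antisym)
  show "hull_fun V (w - t *\<^sub>R ramp V a) p \<le> hull_fun V w p - t * max 0 (a \<bullet> p)"
  proof (rule hull_fun_least)
    fix x assume x: "x \<in> envelope V (w - t *\<^sub>R ramp V a)"
    have *: "- (p \<bullet> (x + - s *\<^sub>R a)) \<le> hull_fun V w p" if "0 \<le> s" "s \<le> t" for s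
      using hull_fun_upper[OF p envelope_add[OF x shift_mem_envelope_ramp[OF that, of a]]] by simp
    show "- (p \<bullet> x) \<le> hull_fun V w p - t * max 0 (a \<bullet> p)"
      using *[of 0] *[of t] assms(2)
      by (auto simp: max_def inner_diff_right inner_commute[of a p])
  qed
  have "hull_fun V w p \<le> hull_fun V (w - t *\<^sub>R ramp V a) p + t * max 0 (a \<bullet> p)"
  proof (rule hull_fun_least)
    fix x assume "x \<in> envelope V w"
    with assms(1,2) obtain s where s: "0 \<le> s" "s \<le> t" "x + s *\<^sub>R a \<in> envelope V (w - t *\<^sub>R ramp V a)"
      by (rule bend_ge_shift)
    have "s * (a \<bullet> p) \<le> t * max 0 (a \<bullet> p)"
      using s(1,2) by (cases "0 \<le> a \<bullet> p") (auto simp: mult_right_mono mult_nonneg_nonpos)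
    moreover have "- (p \<bullet> (x + s *\<^sub>R a)) \<le> hull_fun V (w - t *\<^sub>R ramp V a) p"
      using s(3) p by (intro hull_fun_upper)
    ultimately show "- (p \<bullet> x) \<le> hull_fun V (w - t *\<^sub>R ramp V a) p + t * max 0 (a \<bullet> p)"
      by (simp add: inner_add_right inner_commute[of a p])
  qed
  then show "hull_fun V w p - t * max 0 (a \<bullet> p) \<le> hull_fun V (w - t *\<^sub>R ramp V a) p"
    by simp
qed

text \<open>For positively homogeneous functions convexity is subadditivity. The difference has it
  because \<open>hull_fun_diff_ramp\<close> identifies it as a hull function.\<close>

lemma bend_ge_hull_fun:
  assumes "bend_ge V w a t" "0 \<le> t" and pq: "p \<in> row_cone V UNIV" "q \<in> row_cone V UNIV"
  shows "hull_fun V w (p + q) - t * max 0 (a \<bullet> (p + q)) \<le>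
    (hull_fun V w p - t * max 0 (a \<bullet> p)) + (hull_fun V w q - t * max 0 (a \<bullet> q))"
  using hull_fun_add[OF pq, of "w - t *\<^sub>R ramp V a"] hull_fun_diff_ramp[OF assms(1,2)] pq row_cone_add[OF pq]
  by simp

text \<open>Only segments crossing the hyperplane at \<open>p + q\<close> have to be tested. The
  left side uses a point \<open>x\<close> instead of \<open>hull_fun V w (p + q)\<close>: being
  linear in \<open>p + q\<close>, it allows the limit argument in
  \<open>bend_ge_diff_ramp_other\<close>.\<close>

lemma bend_geI:
  assumes "\<And>p q x. p \<in> row_cone V UNIV \<Longrightarrow> q \<in> row_cone V UNIV \<Longrightarrow> x \<in> envelope V w \<Longrightarrow>
    0 < a \<bullet> p \<Longrightarrow> a \<bullet> (p + q) = 0 \<Longrightarrow>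
    - ((p + q) \<bullet> x) \<le> hull_fun V w p + hull_fun V w q - t * (a \<bullet> p)"
  shows "bend_ge V w a t"
  unfolding bend_ge_def
proof (intro ballI allI impI)
  fix x i j
  assume x: "x \<in> envelope V w" and i: "0 < a \<bullet> row i V" and j: "a \<bullet> row j V < 0"
  define p where "p = (1 / (a \<bullet> row i V)) *\<^sub>R row i V"
  define q where "q = (1 / - (a \<bullet> row j V)) *\<^sub>R row j V"
  have p: "p \<in> row_cone V UNIV" and q: "q \<in> row_cone V UNIV"
    using i j by (auto simp only: p_def q_def intro!: row_cone_scaleR row_cone_row) auto
  have ap: "a \<bullet> p = 1" and aq: "a \<bullet> q = - 1"
    using i j by (auto simp: p_def q_def)
  have fp: "hull_fun V w p \<le> w $ i / (a \<bullet> row i V)"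
  proof -
    have "hull_fun V w p \<le> (1 / (a \<bullet> row i V)) * hull_fun V w (row i V)"
      unfolding p_def using i by (intro hull_fun_scaleR_le row_cone_row) auto
    also have "\<dots> \<le> (1 / (a \<bullet> row i V)) * w $ i"
      using i by (intro mult_left_mono hull_fun_row) auto
    finally show ?thesis by simp
  qed
  have fq: "hull_fun V w q \<le> w $ j / - (a \<bullet> row j V)"
  proof -
    have "hull_fun V w q \<le> (1 / - (a \<bullet> row j V)) * hull_fun V w (row j V)"
      unfolding q_def using j by (intro hull_fun_scaleR_le row_cone_row) auto
    also have "\<dots> \<le> (1 / - (a \<bullet> row j V)) * w $ j"
      using j by (intro mult_left_mono hull_fun_row) auto
    finally show ?thesis by simp
  qed
  have "- ((p + q) \<bullet> x) \<le> hull_fun V w p + hull_fun V w q - t"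
    using assms[OF p q x] ap aq by (simp add: inner_add_right)
  then have "t \<le> p \<bullet> x + w $ i / (a \<bullet> row i V) + (q \<bullet> x + w $ j / - (a \<bullet> row j V))"
    using fp fq by (simp add: inner_add_left)
  then show "t \<le> (row i V \<bullet> x + w $ i) / (a \<bullet> row i V) + (row j V \<bullet> x + w $ j) / (- (a \<bullet> row j V))"
    by (simp add: p_def q_def add_divide_distrib)
qed

lemma bend_ge_hull_funI:
  assumes "\<And>p q. p \<in> row_cone V UNIV \<Longrightarrow> q \<in> row_cone V UNIV \<Longrightarrow>
    hull_fun V w (p + q) - t * max 0 (a \<bullet> (p + q)) \<le>
    (hull_fun V w p - t * max 0 (a \<bullet> p)) + (hull_fun V w q - t * max 0 (a \<bullet> q))"
  shows "bend_ge V w a t"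
proof (rule bend_geI)
  fix p q x
  assume pq: "p \<in> row_cone V UNIV" "q \<in> row_cone V UNIV" and "x \<in> envelope V w"
    and a: "0 < a \<bullet> p" "a \<bullet> (p + q) = 0"
  then have "- ((p + q) \<bullet> x) \<le> hull_fun V w (p + q)"
    by (intro hull_fun_upper row_cone_add)
  with assms[OF pq] a show "- ((p + q) \<bullet> x) \<le> hull_fun V w p + hull_fun V w q - t * (a \<bullet> p)"
    by (simp add: inner_add_right)
qed

text \<open>Both sides say that subtracting \<open>(t + s) * max 0 (a \<bullet> p)\<close> from
  \<open>hull_fun V w\<close> leaves a convex function.\<close>

lemma bend_ge_diff_ramp_same:
  assumes "bend_ge V w a t" "0 \<le> t" "0 \<le> s"
  shows "bend_ge V (w - t *\<^sub>R ramp V a) a s \<longleftrightarrow> bend_ge V w a (t + s)"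
proof
  assume *: "bend_ge V (w - t *\<^sub>R ramp V a) a s"
  show "bend_ge V w a (t + s)"
  proof (rule bend_ge_hull_funI)
    fix p q assume pq: "p \<in> row_cone V UNIV" "q \<in> row_cone V UNIV"
    show "hull_fun V w (p + q) - (t + s) * max 0 (a \<bullet> (p + q)) \<le>
      (hull_fun V w p - (t + s) * max 0 (a \<bullet> p)) + (hull_fun V w q - (t + s) * max 0 (a \<bullet> q))"
      using bend_ge_hull_fun[OF * assms(3) pq] pq row_cone_add[OF pq]
      by (simp add: hull_fun_diff_ramp[OF assms(1,2)] distrib_right)
  qed
next
  assume *: "bend_ge V w a (t + s)"
  have "0 \<le> t + s"
    using assms by simp
  show "bend_ge V (w - t *\<^sub>R ramp V a) a s"
  proof (rule bend_ge_hull_funI)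
    fix p q assume pq: "p \<in> row_cone V UNIV" "q \<in> row_cone V UNIV"
    show "hull_fun V (w - t *\<^sub>R ramp V a) (p + q) - s * max 0 (a \<bullet> (p + q)) \<le>
      (hull_fun V (w - t *\<^sub>R ramp V a) p - s * max 0 (a \<bullet> p)) +
      (hull_fun V (w - t *\<^sub>R ramp V a) q - s * max 0 (a \<bullet> q))"
      using bend_ge_hull_fun[OF * \<open>0 \<le> t + s\<close> pq] pq row_cone_add[OF pq]
      by (simp add: hull_fun_diff_ramp[OF assms(1,2)] distrib_right)
  qed
qed

lemma max0_inner_add_le: "max 0 (a \<bullet> (p + q)) \<le> max 0 (a \<bullet> p) + max 0 (a \<bullet> q)"
  by (auto simp: inner_add_right max_def)

text \<open>Adding back the convex function \<open>t * max 0 (a \<bullet> p)\<close> preserves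
  convexity.\<close>

lemma bend_ge_of_diff_ramp:
  assumes "bend_ge V w a t" "0 \<le> t" "0 \<le> s" and *: "bend_ge V (w - t *\<^sub>R ramp V a) b s"
  shows "bend_ge V w b s"
proof (rule bend_ge_hull_funI)
  fix p q assume pq: "p \<in> row_cone V UNIV" "q \<in> row_cone V UNIV"
  have "t * max 0 (a \<bullet> (p + q)) \<le> t * max 0 (a \<bullet> p) + t * max 0 (a \<bullet> q)"
    using mult_left_mono[OF max0_inner_add_le assms(2)] by (simp add: distrib_left)
  then show "hull_fun V w (p + q) - s * max 0 (b \<bullet> (p + q)) \<le>
    (hull_fun V w p - s * max 0 (b \<bullet> p)) + (hull_fun V w q - s * max 0 (b \<bullet> q))"
    using bend_ge_hull_fun[OF * assms(3) pq] pq row_cone_add[OF pq]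
    by (simp add: hull_fun_diff_ramp[OF assms(1,2)])
qed

text \<open>By \<open>bend_geI\<close> only pairs whose sum lies on the hyperplane of
  \<open>b\<close> matter. If the sum is off the hyperplane of \<open>a\<close>, the two bends are
  at different points of the segment; the remaining pairs are limits of such pairs.\<close>

lemma bend_ge_diff_ramp_other:
  assumes A: "bend_ge V w a t" "0 \<le> t" and B: "bend_ge V w b s" "0 \<le> s"
    and indep: "\<And>k. a \<noteq> k *\<^sub>R b"
  shows "bend_ge V (w - t *\<^sub>R ramp V a) b s"
proof -
  define f where "f = hull_fun V w"
  define g where "g p = f p - t * max 0 (a \<bullet> p) - s * max 0 (b \<bullet> p)" for p
  have h: "hull_fun V (w - t *\<^sub>R ramp V a) p = g p + s * max 0 (b \<bullet> p)" if "p \<in> row_cone V UNIV" for p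
    using hull_fun_diff_ramp[OF A that] by (simp add: g_def f_def)
  have g_scale: "g (c *\<^sub>R p) \<le> c * g p" if "p \<in> row_cone V UNIV" "0 \<le> c" for c p
  proof -
    have max0: "max 0 (c * r) = c * max 0 r" for r :: real
      using \<open>0 \<le> c\<close> by (simp add: max_mult_distrib_left)
    then show ?thesis
      using hull_fun_scaleR_le[OF that, of w] by (simp add: g_def f_def max0 right_diff_distrib mult.left_commute)
  qed
  \<comment> \<open>If one of the ramps is linear on the pair, subadditivity of \<open>g\<close>
    reduces to that of \<open>f\<close> minus the other ramp, which is given.\<close>
  have g_add: "g (p + q) \<le> g p + g q"
    if pq: "p \<in> row_cone V UNIV" "q \<in> row_cone V UNIV"
      and "0 \<le> a \<bullet> p \<and> 0 \<le> a \<bullet> q \<or> a \<bullet> p \<le> 0 \<and> a \<bullet> q \<le> 0 \<or>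
        0 \<le> b \<bullet> p \<and> 0 \<le> b \<bullet> q \<or> b \<bullet> p \<le> 0 \<and> b \<bullet> q \<le> 0" for p q
  proof -
    have "max 0 (c \<bullet> (p + q)) = max 0 (c \<bullet> p) + max 0 (c \<bullet> q)"
      if "0 \<le> c \<bullet> p \<and> 0 \<le> c \<bullet> q \<or> c \<bullet> p \<le> 0 \<and> c \<bullet> q \<le> 0" for c
      using that by (auto simp: inner_add_right)
    then show ?thesis
      using that(3) bend_ge_hull_fun[OF A pq] bend_ge_hull_fun[OF B pq]
      by (auto simp: g_def f_def distrib_left)
  qed
  text \<open>On the segment from \<open>u\<close> to \<open>v\<close> the hyperplane of \<open>a\<close> is met at \<open>p\<close>, before that of \<open>b\<close> at
    \<open>u + v\<close>. The function \<open>g\<close> is convex between \<open>u\<close> and \<open>u + v\<close>, and between \<open>p\<close> and \<open>v\<close>.\<close>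
  have core: "g (u + v) \<le> g u + g v"
    if uv: "u \<in> row_cone V UNIV" "v \<in> row_cone V UNIV" and b: "b \<bullet> (u + v) = 0"
      and a: "0 < a \<bullet> u \<and> a \<bullet> (u + v) < 0 \<or> a \<bullet> u < 0 \<and> 0 < a \<bullet> (u + v)" for u v
  proof -
    define c where "c = - (a \<bullet> u) / (a \<bullet> v)"
    have av: "a \<bullet> v \<noteq> 0"
      using a by (auto simp: inner_add_right)
    have c: "0 < c" "c < 1"
      using a by (auto simp: c_def inner_add_right field_simps)
    define p where "p = u + c *\<^sub>R v"
    have p: "p \<in> row_cone V UNIV"
      using uv c by (auto simp: p_def intro!: row_cone_add row_cone_scaleR)
    have ap: "a \<bullet> p = 0"
      using av by (simp add: p_def inner_diff_right c_def)
    \<comment> \<open>\<open>u\<close> and \<open>u + v\<close> lie on one closed side of the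
      hyperplane of \<open>b\<close>, as the latter contains \<open>u + v\<close>. Below,
      \<open>p\<close> and \<open>v\<close> do so for \<open>a\<close>, as \<open>p\<close> lies on
      its hyperplane. The two inequalities together eliminate \<open>g p\<close>.\<close>
    have "g ((1 - c) *\<^sub>R u + c *\<^sub>R (u + v)) \<le> g ((1 - c) *\<^sub>R u) + g (c *\<^sub>R (u + v))"
      using uv c b by (intro g_add row_cone_scaleR row_cone_add) (auto simp: mult_nonneg_nonpos zero_le_mult_iff mult_le_0_iff)
    also have "\<dots> \<le> (1 - c) * g u + c * g (u + v)"
      using uv c by (intro add_mono g_scale row_cone_add) auto
    also have "(1 - c) *\<^sub>R u + c *\<^sub>R (u + v) = p"
      by (simp add: p_def algebra_simps)
    finally have 1: "g p \<le> (1 - c) * g u + c * g (u + v)" .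
    have "g (p + (1 - c) *\<^sub>R v) \<le> g p + g ((1 - c) *\<^sub>R v)"
      using uv c p ap by (intro g_add row_cone_scaleR) auto
    also have "\<dots> \<le> g p + (1 - c) * g v"
      using uv c by (intro add_left_mono g_scale) auto
    also have "p + (1 - c) *\<^sub>R v = u + v"
      by (simp add: p_def algebra_simps)
    finally have "(1 - c) * g (u + v) \<le> (1 - c) * (g u + g v)"
      using 1 by (simp add: algebra_simps)
    then show ?thesis
      using c by simp
  qed
  have generic: "g (u + v) \<le> g u + g v"
    if uv: "u \<in> row_cone V UNIV" "v \<in> row_cone V UNIV" and b: "b \<bullet> (u + v) = 0" "a \<bullet> (u + v) \<noteq> 0" for u v
  proof (cases "0 \<le> a \<bullet> u \<and> 0 \<le> a \<bullet> v \<or> a \<bullet> u \<le> 0 \<and> a \<bullet> v \<le> 0")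
    case True
    then show ?thesis
      using g_add uv by blast
  next
    case False
    \<comment> \<open>\<open>u\<close> and \<open>v\<close> lie strictly on opposite sides of the
      hyperplane of \<open>a\<close>, and \<open>u + v\<close> lies off it. So the crossing falls
      either between \<open>u\<close> and \<open>u + v\<close> or between \<open>v\<close> and
      \<open>u + v\<close>.\<close>
    then consider "0 < a \<bullet> u \<and> a \<bullet> (u + v) < 0 \<or> a \<bullet> u < 0 \<and> 0 < a \<bullet> (u + v)"
      | "0 < a \<bullet> v \<and> a \<bullet> (v + u) < 0 \<or> a \<bullet> v < 0 \<and> 0 < a \<bullet> (v + u)"
      using b(2) by (auto simp: inner_add_right add.commute linorder_neq_iff)
    then show ?thesis
      using core[of u v] core[of v u] uv b by cases (auto simp: add.commute)
  qed
  show ?thesis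
  proof (rule bend_geI)
    fix u v x
    assume uv: "u \<in> row_cone V UNIV" "v \<in> row_cone V UNIV" and x: "x \<in> envelope V (w - t *\<^sub>R ramp V a)"
      and bu: "0 < b \<bullet> u" and b0: "b \<bullet> (u + v) = 0"
    have bv: "b \<bullet> v < 0"
      using bu b0 by (simp add: inner_add_right)
    have "- ((u + v) \<bullet> x) \<le> g u + g v"
    proof (cases "a \<bullet> (u + v) = 0")
      case False
      have "- ((u + v) \<bullet> x) \<le> g (u + v)"
        using hull_fun_upper[OF row_cone_add[OF uv] x] h[OF row_cone_add[OF uv]] b0 by simp
      with generic[OF uv b0 False] show ?thesis by simp
    next
      case True
      text \<open>The two hyperplanes meet the segment in the same point: move \<open>v\<close> along the hyperplane
        through \<open>v\<close> parallel to that of \<open>b\<close>.\<close>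
      define k' where "k' = (a \<bullet> v) / (b \<bullet> v)"
      have "a - k' *\<^sub>R b \<noteq> 0"
        using indep by simp
      then obtain i where i: "row i V \<bullet> (a - k' *\<^sub>R b) \<noteq> 0"
        using rows_spanning by blast
      define z where "z = row i V"
      have z: "z \<in> row_cone V UNIV"
        by (simp add: z_def row_cone_row)
      define k where "k = (b \<bullet> z) / (b \<bullet> v)"
      define ve where "ve e = v + e *\<^sub>R (z - k *\<^sub>R v)" for e
      have bve: "b \<bullet> ve e = b \<bullet> v" for e
        using bv by (simp add: ve_def inner_add_right inner_diff_right k_def)
      have ave: "a \<bullet> (u + ve e) = e * (row i V \<bullet> (a - k' *\<^sub>R b))" for e
      proof -
        have "a \<bullet> (u + ve e) = e * (a \<bullet> z - k * (a \<bullet> v))"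
          using True by (simp add: ve_def inner_add_right inner_diff_right)
        also have "k * (a \<bullet> v) = k' * (b \<bullet> z)"
          by (simp add: k_def k'_def)
        finally show ?thesis
          by (simp add: z_def inner_diff_right inner_commute)
      qed
      have ve_cone: "ve e \<in> row_cone V UNIV" if "0 < e" "e * k < 1" for e
      proof -
        have "ve e = (1 - e * k) *\<^sub>R v + e *\<^sub>R z"
          by (simp add: ve_def algebra_simps)
        then show ?thesis
          using that uv(2) z by (auto intro!: row_cone_add row_cone_scaleR)
      qed
      \<comment> \<open>Subadditivity replaces \<open>f (ve e)\<close> by an expression affine in
        \<open>e\<close>, so both sides converge as \<open>e\<close> tends to 0 from the
        right.\<close>
      have bound: "- ((u + ve e) \<bullet> x) \<le>
          g u + ((1 - e * k) * f v + e * f z - t * max 0 (a \<bullet> ve e) - s * max 0 (b \<bullet> v))"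
        if e: "0 < e" "e * k < 1" for e
      proof -
        note c = row_cone_add[OF uv(1) ve_cone[OF e]]
        have be: "b \<bullet> (u + ve e) = 0"
          using b0 bve[of e] by (simp add: inner_add_right)
        have "- ((u + ve e) \<bullet> x) \<le> g (u + ve e)"
          using hull_fun_upper[OF c x] h[OF c] be by simp
        also have "\<dots> \<le> g u + g (ve e)"
          using ave[of e] i e(1) be by (intro generic uv ve_cone e) auto
        also have "f (ve e) \<le> (1 - e * k) * f v + e * f z"
        proof -
          have "ve e = (1 - e * k) *\<^sub>R v + e *\<^sub>R z"
            by (simp add: ve_def algebra_simps)
          then have "f (ve e) \<le> f ((1 - e * k) *\<^sub>R v) + f (e *\<^sub>R z)"
            using e uv(2) z unfolding f_def
            by (auto intro!: hull_fun_add row_cone_scaleR)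
          also have "\<dots> \<le> (1 - e * k) * f v + e * f z"
            unfolding f_def using e uv(2) z by (intro add_mono hull_fun_scaleR_le) auto
          finally show ?thesis .
        qed
        then have "g (ve e) \<le> (1 - e * k) * f v + e * f z - t * max 0 (a \<bullet> ve e) - s * max 0 (b \<bullet> v)"
          by (simp add: g_def bve)
        finally show ?thesis by simp
      qed
      have "eventually (\<lambda>e. e * k < 1) (at_right 0)"
        by (rule order_tendstoD(2)[where y = 0]) (auto intro!: tendsto_eq_intros)
      moreover have "eventually (\<lambda>e::real. 0 < e) (at_right 0)"
        by (rule eventually_at_right_less)
      ultimately have ev: "eventually (\<lambda>e. - ((u + ve e) \<bullet> x) \<le>
          g u + ((1 - e * k) * f v + e * f z - t * max 0 (a \<bullet> ve e) - s * max 0 (b \<bullet> v))) (at_right 0)"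
        by eventually_elim (rule bound)
      have l1: "((\<lambda>e. - ((u + ve e) \<bullet> x)) \<longlongrightarrow> - ((u + v) \<bullet> x)) (at_right 0)"
        unfolding ve_def by (auto intro!: tendsto_eq_intros)
      have "((\<lambda>e. g u + ((1 - e * k) * f v + e * f z - t * max 0 (a \<bullet> ve e) - s * max 0 (b \<bullet> v)))
          \<longlongrightarrow> g u + ((1 - 0 * k) * f v + 0 * f z - t * max 0 (a \<bullet> (v + 0 *\<^sub>R (z - k *\<^sub>R v))) - s * max 0 (b \<bullet> v)))
          (at_right 0)"
        unfolding ve_def by (intro tendsto_intros)
      then have l2: "((\<lambda>e. g u + ((1 - e * k) * f v + e * f z - t * max 0 (a \<bullet> ve e) - s * max 0 (b \<bullet> v)))
          \<longlongrightarrow> g u + g v) (at_right 0)"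
        by (simp add: g_def)
      show ?thesis
        by (rule tendsto_le[OF _ l2 l1 ev]) simp
    qed
    then show "- ((u + v) \<bullet> x) \<le> hull_fun V (w - t *\<^sub>R ramp V a) u +
        hull_fun V (w - t *\<^sub>R ramp V a) v - s * (b \<bullet> u)"
      using bu bv by (simp add: h uv)
  qed
qed

subsection \<open>Vertices of envelopes and the coherency index\<close>

text \<open>Along a direction orthogonal to all tight rows, a short step both ways stays in the
  envelope. Conversely, a row tight inside a segment of the envelope is tight at both ends.\<close>

lemma vertices_envelope:
  "x \<in> vertices (envelope V w) \<longleftrightarrow>
     x \<in> envelope V w \<and> (\<forall>d. (\<forall>i. row i V \<bullet> x = - w $ i \<longrightarrow> row i V \<bullet> d = 0) \<longrightarrow> d = 0)"
proof
  assume "x \<in> vertices (envelope V w)"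
  then have x: "x \<in> envelope V w"
    and ext: "\<And>p q. p \<in> envelope V w \<Longrightarrow> q \<in> envelope V w \<Longrightarrow> x \<notin> open_segment p q"
    by (auto simp: vertices_def extreme_point_of_def)
  have "d = 0" if d: "\<And>i. row i V \<bullet> x = - w $ i \<Longrightarrow> row i V \<bullet> d = 0" for d
  proof (rule ccontr)
    assume "d \<noteq> 0"
    \<comment> \<open>Step lengths allowed by the slacks. The element \<open>1\<close> keeps the set
      nonempty, and the \<open>1\<close> in the denominator avoids division by zero.\<close>
    define E where "E = insert 1 ((\<lambda>i. (row i V \<bullet> x + w $ i) / (1 + \<bar>row i V \<bullet> d\<bar>)) ` nontight V w x)"
    have E: "finite E" "E \<noteq> {}"
      by (auto simp: E_def)
    define e where "e = Min E"
    have "0 < r" if "r \<in> E" for r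
      using that x by (auto simp: E_def nontight_def mem_envelope intro!: divide_pos_pos)
        (smt (verit))
    then have e: "0 < e"
      using E by (simp add: e_def)
    have small: "e * \<bar>row i V \<bullet> d\<bar> \<le> row i V \<bullet> x + w $ i" for i
    proof (cases "i \<in> nontight V w x")
      case True
      then have "e \<le> (row i V \<bullet> x + w $ i) / (1 + \<bar>row i V \<bullet> d\<bar>)"
        using E by (auto simp: e_def E_def intro!: Min_le)
      then have "e * (1 + \<bar>row i V \<bullet> d\<bar>) \<le> row i V \<bullet> x + w $ i"
        by (simp add: pos_le_divide_eq)
      with e show ?thesis
        by (simp add: algebra_simps)
    next
      case False
      with d show ?thesis
        by (simp add: nontight_def)
    qed
    have "x + e *\<^sub>R d \<in> envelope V w" "x - e *\<^sub>R d \<in> envelope V w"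
    proof -
      have "\<bar>e * (row i V \<bullet> d)\<bar> \<le> row i V \<bullet> x + w $ i" for i
        using small[of i] e by (simp add: abs_mult)
      then have *: "- w $ i \<le> row i V \<bullet> x + e * (row i V \<bullet> d)" "- w $ i \<le> row i V \<bullet> x - e * (row i V \<bullet> d)" for i
        by (smt (verit))+
      show "x + e *\<^sub>R d \<in> envelope V w" "x - e *\<^sub>R d \<in> envelope V w"
        using * by (simp_all add: mem_envelope inner_add_right inner_diff_right)
    qed
    moreover have "x \<in> open_segment (x + e *\<^sub>R d) (x - e *\<^sub>R d)"
    proof -
      have "(x + e *\<^sub>R d) - (x - e *\<^sub>R d) = (2 * e) *\<^sub>R d"
        by (simp add: vec_eq_iff)
      then have ne: "x + e *\<^sub>R d \<noteq> x - e *\<^sub>R d"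
        using e \<open>d \<noteq> 0\<close> by auto
      have eq: "x = (1 - 1 / 2) *\<^sub>R (x + e *\<^sub>R d) + (1 / 2) *\<^sub>R (x - e *\<^sub>R d)"
        by (simp add: vec_eq_iff field_simps)
      show ?thesis
        unfolding in_segment by (intro conjI exI[of _ "1/2"] ne eq) auto
    qed
    ultimately show False
      using ext by blast
  qed
  with x show "x \<in> envelope V w \<and> (\<forall>d. (\<forall>i. row i V \<bullet> x = - w $ i \<longrightarrow> row i V \<bullet> d = 0) \<longrightarrow> d = 0)"
    by blast
next
  assume *: "x \<in> envelope V w \<and> (\<forall>d. (\<forall>i. row i V \<bullet> x = - w $ i \<longrightarrow> row i V \<bullet> d = 0) \<longrightarrow> d = 0)"
  have False if p: "p \<in> envelope V w" and q: "q \<in> envelope V w" and x: "x \<in> open_segment p q" for p q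
  proof -
    obtain u where u: "p \<noteq> q" "0 < u" "u < 1" "x = (1 - u) *\<^sub>R p + u *\<^sub>R q"
      using x by (auto simp: in_segment)
    have "row i V \<bullet> (p - q) = 0" if "row i V \<bullet> x = - w $ i" for i
    proof -
      have "(1 - u) * (row i V \<bullet> p + w $ i) + u * (row i V \<bullet> q + w $ i) = 0"
        using that by (simp add: u(4) inner_add_right algebra_simps)
      moreover have pq: "0 \<le> row i V \<bullet> p + w $ i" "0 \<le> row i V \<bullet> q + w $ i"
        using p q by (auto simp: mem_envelope minus_le_iff dest!: spec[of _ i])
      moreover have "0 \<le> (1 - u) * (row i V \<bullet> p + w $ i)" "0 \<le> u * (row i V \<bullet> q + w $ i)"
        using pq u by simp_all
      ultimately have "(1 - u) * (row i V \<bullet> p + w $ i) = 0" "u * (row i V \<bullet> q + w $ i) = 0"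
        by linarith+
      then show ?thesis
        using u by (simp add: inner_diff_right)
    qed
    then have "p - q = 0"
      using * by blast
    with u show False by simp
  qed
  with * show "x \<in> vertices (envelope V w)"
    by (auto simp: vertices_def extreme_point_of_def)
qed

text \<open>A vertex is determined by its set of nontight rows.\<close>

lemma finite_vertices_envelope: "finite (vertices (envelope V w))"
proof (rule inj_on_finite)
  show "inj_on (nontight V w) (vertices (envelope V w))"
  proof (rule inj_onI)
    fix x x' assume x: "x \<in> vertices (envelope V w)" and *: "nontight V w x = nontight V w x'"
    have "row i V \<bullet> x' = - w $ i" if "row i V \<bullet> x = - w $ i" for i
      using that * by (auto simp: nontight_def)
    then have "x - x' = 0"
      using x unfolding vertices_envelope by (metis inner_diff_right right_minus_eq)
    then show "x = x'" by simp
  qed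
qed auto

text \<open>Ratio test of the simplex method: move along \<open>d\<close> up to the first row that
  becomes tight.\<close>

lemma envelope_move:
  assumes x: "x \<in> envelope V w" and d: "\<And>i. row i V \<bullet> x = - w $ i \<Longrightarrow> row i V \<bullet> d = 0"
    and j: "row j V \<bullet> d < 0"
  obtains e where "0 \<le> e" "x + e *\<^sub>R d \<in> envelope V w"
    "nontight V w (x + e *\<^sub>R d) \<subset> nontight V w x"
proof -
  define R where "R i = (row i V \<bullet> x + w $ i) / - (row i V \<bullet> d)" for i
  define J where "J = {i. row i V \<bullet> d < 0}"
  have J: "finite (R ` J)" "R ` J \<noteq> {}"
    using j by (auto simp: J_def)
  define e where "e = Min (R ` J)"
  have slack: "0 \<le> row i V \<bullet> x + w $ i" for i
    using x by (auto simp: mem_envelope minus_le_iff dest!: spec[of _ i])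
  have e: "0 \<le> e"
    unfolding e_def
  proof (rule Min.boundedI[OF J])
    fix r assume "r \<in> R ` J"
    then show "0 \<le> r"
      using slack by (auto simp: R_def J_def divide_nonneg_neg)
  qed
  have "e \<in> R ` J"
    unfolding e_def using J by (rule Min_in)
  then obtain i where i: "row i V \<bullet> d < 0" "e = R i"
    by (auto simp: J_def)
  have "i \<in> nontight V w x"
    using i(1) d[of i] by (auto simp: nontight_def)
  moreover have "row i V \<bullet> (x + e *\<^sub>R d) = - w $ i"
    using i by (simp add: inner_diff_right R_def)
  then have "i \<notin> nontight V w (x + e *\<^sub>R d)"
    by (simp add: nontight_def)
  moreover have "nontight V w (x + e *\<^sub>R d) \<subseteq> nontight V w x"
    using d by (auto simp: nontight_def inner_add_right)
  moreover have "x + e *\<^sub>R d \<in> envelope V w"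
    unfolding mem_envelope
  proof
    fix k
    show "- w $ k \<le> row k V \<bullet> (x + e *\<^sub>R d)"
    proof (cases "row k V \<bullet> d < 0")
      case True
      then have "e \<le> R k"
        using J by (auto simp: e_def J_def intro!: Min_le)
      then have "e * - (row k V \<bullet> d) \<le> row k V \<bullet> x + w $ k"
        using True unfolding R_def by (subst (asm) pos_le_divide_eq) auto
      then show ?thesis
        by (simp add: inner_add_right)
    next
      case False
      then have "0 \<le> e * (row k V \<bullet> d)"
        using e by simp
      then show ?thesis
        using slack[of k] by (simp add: inner_add_right)
    qed
  qed
  ultimately show ?thesis
    using that e by blast
qed

text \<open>Among the points with objective at most \<open>c \<bullet> x\<close>, one with the
  fewest nontight rows is a vertex, since otherwise \<open>envelope_move\<close> would make another
  row tight.\<close>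

lemma envelope_minimizing_vertex:
  assumes x: "x \<in> envelope V w" and bdd: "\<And>x. x \<in> envelope V w \<Longrightarrow> B \<le> c \<bullet> x"
  obtains z where "z \<in> vertices (envelope V w)" "c \<bullet> z \<le> c \<bullet> x"
proof -
  obtain z where z: "z \<in> envelope V w" "c \<bullet> z \<le> c \<bullet> x"
    and min: "\<And>z'. z' \<in> envelope V w \<Longrightarrow> c \<bullet> z' \<le> c \<bullet> x \<Longrightarrow>
      card (nontight V w z) \<le> card (nontight V w z')"
    using ex_has_least_nat[of "\<lambda>z. z \<in> envelope V w \<and> c \<bullet> z \<le> c \<bullet> x" x "\<lambda>z. card (nontight V w z)"] x
    by auto
  have "d = 0" if tight: "\<And>i. row i V \<bullet> z = - w $ i \<Longrightarrow> row i V \<bullet> d = 0" for d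
  proof (rule ccontr)
    assume "d \<noteq> 0"
    have no_descent: False
      if d: "\<And>i. row i V \<bullet> z = - w $ i \<Longrightarrow> row i V \<bullet> d = 0" and j: "row j V \<bullet> d < 0" and c: "c \<bullet> d \<le> 0" for j d
    proof -
      obtain e where e: "0 \<le> e" "z + e *\<^sub>R d \<in> envelope V w"
          "nontight V w (z + e *\<^sub>R d) \<subset> nontight V w z"
        using envelope_move[OF z(1) d j] by blast
      have "c \<bullet> (z + e *\<^sub>R d) \<le> c \<bullet> x"
        using z(2) mult_nonneg_nonpos[OF e(1) c] by (simp add: inner_add_right)
      then show False
        using min[OF e(2)] psubset_card_mono[OF _ e(3)] by simp
    qed
    \<comment> \<open>A direction in which no row decreases never leaves the envelope, so descent
      along it would carry the objective below \<open>B\<close>.\<close>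
    have ascent: "0 \<le> c \<bullet> d" if nn: "\<And>i. 0 \<le> row i V \<bullet> d" for d
    proof (rule ccontr)
      assume neg: "\<not> 0 \<le> c \<bullet> d"
      define t where "t = (c \<bullet> z - B + 1) / - (c \<bullet> d)"
      have t: "0 \<le> t"
        using bdd[OF z(1)] neg by (simp add: t_def divide_nonneg_neg)
      have "z + t *\<^sub>R d \<in> envelope V w"
        using z(1) t nn by (auto simp: mem_envelope inner_add_right intro: order_trans)
      moreover have "c \<bullet> (z + t *\<^sub>R d) = B - 1"
        using neg by (simp add: t_def inner_diff_right)
      ultimately show False
        using bdd by fastforce
    qed
    \<comment> \<open>The sign keeps the objective from increasing. Then no row decreases along
      \<open>d'\<close>, so the objective is constant along it, and the opposite direction, in which
      some row decreases, contradicts \<open>no_descent\<close>.\<close>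
    define d' where "d' = (if c \<bullet> d \<le> 0 then d else - d)"
    have d': "c \<bullet> d' \<le> 0" "d' \<noteq> 0" "\<And>i. row i V \<bullet> z = - w $ i \<Longrightarrow> row i V \<bullet> d' = 0"
      using \<open>d \<noteq> 0\<close> tight by (auto simp: d'_def)
    have nn: "0 \<le> row i V \<bullet> d'" for i
      using no_descent[of d' i] d' by force
    then have "c \<bullet> d' = 0"
      using ascent[of d'] d'(1) by simp
    moreover obtain i where "row i V \<bullet> d' \<noteq> 0"
      using rows_spanning d'(2) by blast
    then have "row i V \<bullet> - d' < 0"
      using nn[of i] by simp
    ultimately show False
      using no_descent[of "- d'" i] d'(3) by simp
  qed
  then have "z \<in> vertices (envelope V w)"
    using z(1) vertices_envelope by blast
  with z(2) that show ?thesis by blast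
qed

lemma vertices_envelope_nonempty: "vertices (envelope V w) \<noteq> {}"
proof -
  obtain x where "x \<in> envelope V w"
    using envelope_nonempty by blast
  then show ?thesis
    using envelope_minimizing_vertex[of x w 0 0] by auto
qed

section \<open>The envelope of a split weight and thresholds for the index\<close>

lemma split_normal_uminus: "split_normal V (- a) \<longleftrightarrow> split_normal V a"
  by (auto simp: split_normal_def)

text \<open>A row on the positive side is a linear combination of a row on the negative side and
  rows on the hyperplane, so the rows of one closed side already span.\<close>

lemma split_normal_halfspace_spanning:
  assumes a: "split_normal V a" and d: "\<And>i. a \<bullet> row i V \<le> 0 \<Longrightarrow> row i V \<bullet> d = 0"
  shows "d = 0"
proof (rule rows_spanning)
  fix i
  show "row i V \<bullet> d = 0"
  proof (cases "a \<bullet> row i V \<le> 0")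
    case False
    obtain j where j: "a \<bullet> row j V < 0"
      using a by (auto simp: split_normal_def)
    define q where "q = - (a \<bullet> row j V) *\<^sub>R row i V + (a \<bullet> row i V) *\<^sub>R row j V"
    have "q \<in> row_cone V UNIV"
      unfolding q_def using False j by (intro row_cone_add row_cone_scaleR row_cone_row) auto
    moreover have "a \<bullet> q = 0"
      by (simp add: q_def inner_diff_right)
    ultimately obtain c where c: "q = (\<Sum>i | a \<bullet> row i V = 0. c i *\<^sub>R row i V)"
      using a unfolding split_normal_def row_cone_def by blast
    have "q \<bullet> d = 0"
      by (simp add: c inner_sum_left d)
    then show ?thesis
      using j d[of j] by (simp add: q_def inner_diff_left)
  qed (rule d)
qed

text \<open>By \<open>bend_ge_shift\<close> a vertex has the form \<open>c - s *\<^sub>R a\<close>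
  with \<open>c\<close> in \<open>envelope V 0\<close>. It is the midpoint of
  \<open>c + c - s *\<^sub>R a\<close> and \<open>- s *\<^sub>R a\<close>, so \<open>c = 0\<close>;
  on the segment from \<open>0\<close> to \<open>- a\<close> only the ends are extreme.\<close>

lemma vertices_envelope_ramp:
  assumes a: "split_normal V a"
  shows "vertices (envelope V (ramp V a)) = {0, - a}"
proof
  have mem: "- s *\<^sub>R a \<in> envelope V (ramp V a)" if "0 \<le> s" "s \<le> 1" for s
    using shift_mem_envelope_ramp[of s 1 a V] that by simp
  show "vertices (envelope V (ramp V a)) \<subseteq> {0, - a}"
  proof
    fix x assume "x \<in> vertices (envelope V (ramp V a))"
    then have x: "x \<in> envelope V (ramp V a)"
      and ext: "\<And>p q. p \<in> envelope V (ramp V a) \<Longrightarrow> q \<in> envelope V (ramp V a) \<Longrightarrow> x \<notin> open_segment p q"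
      by (auto simp: vertices_def extreme_point_of_def)
    have "bend_ge V (ramp V a) a 1"
      using bend_ge_ramp[OF a, of 1] by simp
    from bend_ge_shift[OF this _ x] obtain s where s: "0 \<le> s" "s \<le> 1"
      and c: "x + s *\<^sub>R a \<in> envelope V 0"
      by auto
    define c where "c = x + s *\<^sub>R a"
    have "c + c \<in> envelope V 0"
      using envelope_add[OF c c] by (simp add: c_def)
    from envelope_add[OF this mem[OF s]] have "c + c - s *\<^sub>R a \<in> envelope V (ramp V a)"
      by simp
    from ext[OF this mem[OF s]] have "c = 0"
    proof (rule contrapos_np)
      assume "c \<noteq> 0"
      have "x = (1 - 1 / 2) *\<^sub>R (c + c - s *\<^sub>R a) + (1 / 2) *\<^sub>R (- s *\<^sub>R a)"
        by (simp add: vec_eq_iff c_def field_simps)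
      with \<open>c \<noteq> 0\<close> show "x \<in> open_segment (c + c - s *\<^sub>R a) (- s *\<^sub>R a)"
        unfolding in_segment by (intro conjI exI[of _ "1/2"]) (auto simp flip: scaleR_2)
    qed
    then have x_eq: "x = - s *\<^sub>R a"
      by (simp add: c_def eq_neg_iff_add_eq_0)
    have "a \<noteq> 0"
      using a by (auto simp: split_normal_def)
    have "x \<in> open_segment 0 (- a)" if "0 < s" "s < 1"
      using that \<open>a \<noteq> 0\<close> x_eq unfolding in_segment by (auto intro!: exI[of _ s])
    then have "s = 0 \<or> s = 1"
      using s ext[OF mem[of 0] mem[of 1]] by fastforce
    then show "x \<in> {0, - a}"
      using x_eq by auto
  qed
  have "0 \<in> vertices (envelope V (ramp V a))"
    unfolding vertices_envelope using mem[of 0] split_normal_halfspace_spanning[OF a] by auto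
  moreover have "- a \<in> vertices (envelope V (ramp V a))"
    unfolding vertices_envelope
  proof (intro conjI allI impI)
    fix d assume d: "\<forall>i. row i V \<bullet> - a = - ramp V a $ i \<longrightarrow> row i V \<bullet> d = 0"
    show "d = 0"
      using d by (intro split_normal_halfspace_spanning[of "- a"]) (auto simp: split_normal_uminus a inner_commute)
  qed (use mem[of 1] in simp)
  ultimately show "{0, - a} \<subseteq> vertices (envelope V (ramp V a))"
    by simp
qed

text \<open>At each of the vertices \<open>0\<close> and \<open>- a\<close> the nontight rows are
  those strictly on one side. Comparing with a threshold turns the minima into quantifiers and the
  maximum into a disjunction.\<close>

lemma le_coherency_index_ramp_iff_vertices:
  assumes a: "split_normal V a"
  shows "t \<le> coherency_index V w (ramp V a) \<longleftrightarrow>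
    (\<forall>x\<in>vertices (envelope V w).
       (\<forall>i. 0 < a \<bullet> row i V \<longrightarrow> t \<le> (row i V \<bullet> x + w $ i) / (a \<bullet> row i V)) \<or>
       (\<forall>j. a \<bullet> row j V < 0 \<longrightarrow> t \<le> (row j V \<bullet> x + w $ j) / - (a \<bullet> row j V)))"
proof -
  define m where "m x x' = (MIN i\<in>nontight V (ramp V a) x'.
    (row i V \<bullet> x + w $ i) / (row i V \<bullet> x' + ramp V a $ i))" for x x'
  have nt: "nontight V (ramp V a) 0 = {i. 0 < a \<bullet> row i V}" "nontight V (ramp V a) (- a) = {i. a \<bullet> row i V < 0}"
    by (auto simp: nontight_def max_def inner_commute[of _ a])
  have ne: "{i. 0 < a \<bullet> row i V} \<noteq> {}" "{i. a \<bullet> row i V < 0} \<noteq> {}"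
    using a by (auto simp: split_normal_def)
  have m0: "t \<le> m x 0 \<longleftrightarrow> (\<forall>i. 0 < a \<bullet> row i V \<longrightarrow> t \<le> (row i V \<bullet> x + w $ i) / (a \<bullet> row i V))" for x
    using ne unfolding m_def nt by (subst Min_ge_iff) auto
  have ma: "t \<le> m x (- a) \<longleftrightarrow> (\<forall>j. a \<bullet> row j V < 0 \<longrightarrow> t \<le> (row j V \<bullet> x + w $ j) / - (a \<bullet> row j V))" for x
    using ne unfolding m_def nt by (subst Min_ge_iff) (auto simp: inner_commute[of _ a])
  have "coherency_index V w (ramp V a) = (MIN x\<in>vertices (envelope V w). MAX x'\<in>{0, - a}. m x x')"
    by (simp add: coherency_index_def vertices_envelope_ramp[OF a] m_def)
  then have "t \<le> coherency_index V w (ramp V a) \<longleftrightarrow>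
      (\<forall>x\<in>vertices (envelope V w). t \<le> (MAX x'\<in>{0, - a}. m x x'))"
    using finite_vertices_envelope vertices_envelope_nonempty by (simp add: Min_ge_iff)
  also have "\<dots> \<longleftrightarrow> (\<forall>x\<in>vertices (envelope V w). t \<le> m x 0 \<or> t \<le> m x (- a))"
    by (simp add: le_max_iff_disj)
  finally show ?thesis
    by (simp add: m0 ma)
qed

text \<open>The sum of the two ratios is affine in \<open>x\<close>, so its minimum over the envelope is attained at a
  vertex. At a vertex one of the two minima of ratios vanishes, so that their maximum is their sum.\<close>

lemma le_coherency_index_ramp_iff:
  assumes a: "split_normal V a" and t: "0 \<le> t"
  shows "t \<le> coherency_index V w (ramp V a) \<longleftrightarrow> bend_ge V w a t"
proof
  have slack: "0 \<le> row i V \<bullet> x + w $ i" if "x \<in> envelope V w" for i x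
    using that by (auto simp: mem_envelope minus_le_iff dest!: spec[of _ i])
  assume *: "t \<le> coherency_index V w (ramp V a)"
  show "bend_ge V w a t"
    unfolding bend_ge_def
  proof (intro ballI allI impI)
    fix x i j
    assume x: "x \<in> envelope V w" and i: "0 < a \<bullet> row i V" and j: "a \<bullet> row j V < 0"
    define c where "c = (1 / (a \<bullet> row i V)) *\<^sub>R row i V + (1 / - (a \<bullet> row j V)) *\<^sub>R row j V"
    define C where "C = w $ i / (a \<bullet> row i V) + w $ j / - (a \<bullet> row j V)"
    have eq: "(row i V \<bullet> z + w $ i) / (a \<bullet> row i V) + (row j V \<bullet> z + w $ j) / - (a \<bullet> row j V) = c \<bullet> z + C" for z
      by (simp add: c_def C_def inner_diff_left add_divide_distrib)
    have nn: "0 \<le> (row i V \<bullet> z + w $ i) / (a \<bullet> row i V)" "0 \<le> (row j V \<bullet> z + w $ j) / - (a \<bullet> row j V)"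
      if "z \<in> envelope V w" for z
      using slack[OF that, of i] slack[OF that, of j] i j by (auto intro: divide_nonneg_neg)
    have "- C \<le> c \<bullet> z" if "z \<in> envelope V w" for z
      using nn[OF that] eq[of z] by linarith
    then obtain z where z: "z \<in> vertices (envelope V w)" "c \<bullet> z \<le> c \<bullet> x"
      using envelope_minimizing_vertex[OF x, of "- C" c] by blast
    then have "z \<in> envelope V w"
      by (simp add: vertices_envelope)
    from * z(1) consider "t \<le> (row i V \<bullet> z + w $ i) / (a \<bullet> row i V)"
      | "t \<le> (row j V \<bullet> z + w $ j) / - (a \<bullet> row j V)"
      unfolding le_coherency_index_ramp_iff_vertices[OF a] using i j by blast
    then have "t \<le> (row i V \<bullet> z + w $ i) / (a \<bullet> row i V) + (row j V \<bullet> z + w $ j) / - (a \<bullet> row j V)"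
      using nn[OF \<open>z \<in> envelope V w\<close>] by cases linarith+
    with z(2) show "t \<le> (row i V \<bullet> x + w $ i) / (a \<bullet> row i V) + (row j V \<bullet> x + w $ j) / - (a \<bullet> row j V)"
      unfolding eq by linarith
  qed
next
  assume *: "bend_ge V w a t"
  show "t \<le> coherency_index V w (ramp V a)"
    unfolding le_coherency_index_ramp_iff_vertices[OF a]
  proof
    fix x assume x: "x \<in> vertices (envelope V w)"
    have "a \<noteq> 0"
      using a by (auto simp: split_normal_def)
    \<comment> \<open>The tight rows span, so one of them lies off the hyperplane. Its ratio is 0,
      and \<open>b\<close> with this row fixed bounds all ratios on the other side.\<close>
    then obtain k where k: "row k V \<bullet> x = - w $ k" "a \<bullet> row k V \<noteq> 0"
      using x unfolding vertices_envelope by (metis inner_commute)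
    have b: "t \<le> (row i V \<bullet> x + w $ i) / (a \<bullet> row i V) + (row j V \<bullet> x + w $ j) / - (a \<bullet> row j V)"
      if "0 < a \<bullet> row i V" "a \<bullet> row j V < 0" for i j
      using * x that unfolding bend_ge_def vertices_envelope by blast
    show "(\<forall>i. 0 < a \<bullet> row i V \<longrightarrow> t \<le> (row i V \<bullet> x + w $ i) / (a \<bullet> row i V)) \<or>
       (\<forall>j. a \<bullet> row j V < 0 \<longrightarrow> t \<le> (row j V \<bullet> x + w $ j) / - (a \<bullet> row j V))"
    proof (cases "0 < a \<bullet> row k V")
      case True
      then show ?thesis
        using b[of k] k by auto
    next
      case False
      then have "a \<bullet> row k V < 0"
        using k(2) by simp
      then show ?thesis
        using b[of _ k] k by auto
    qed
  qed
qed

lemma coherency_index_ramp_nonneg: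
  assumes "split_normal V a"
  shows "0 \<le> coherency_index V w (ramp V a)"
proof -
  have "bend_ge V w a 0"
    by (rule bend_ge_shiftI) (auto intro!: exI[of _ 0])
  then show ?thesis
    using le_coherency_index_ramp_iff[OF assms, of 0 w] by simp
qed

subsection \<open>Subtracting several split weights\<close>

text \<open>The indices are nonnegative, so comparison with all thresholds \<open>s \<ge> 0\<close>
  determines them.\<close>

lemma coherency_index_ramp_diff_same:
  assumes a: "split_normal V a" and A: "bend_ge V w a t" "0 \<le> t"
  shows "coherency_index V (w - t *\<^sub>R ramp V a) (ramp V a) = coherency_index V w (ramp V a) - t"
proof -
  let ?w = "coherency_index V w (ramp V a)" and ?w' = "coherency_index V (w - t *\<^sub>R ramp V a) (ramp V a)"
  have iff: "s \<le> ?w' \<longleftrightarrow> t + s \<le> ?w" if "0 \<le> s" for s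
    using le_coherency_index_ramp_iff[OF a] bend_ge_diff_ramp_same[OF A] A(2) that by simp
  have "t \<le> ?w"
    using le_coherency_index_ramp_iff[OF a] A by simp
  then show ?thesis
    using iff[of ?w'] iff[of "?w - t"] coherency_index_ramp_nonneg[OF a] by force
qed

lemma coherency_index_ramp_diff_other:
  assumes b: "split_normal V b" and A: "bend_ge V w a t" "0 \<le> t" and indep: "\<And>k. a \<noteq> k *\<^sub>R b"
  shows "coherency_index V (w - t *\<^sub>R ramp V a) (ramp V b) = coherency_index V w (ramp V b)"
proof -
  let ?w = "coherency_index V w (ramp V b)" and ?w' = "coherency_index V (w - t *\<^sub>R ramp V a) (ramp V b)"
  have iff: "s \<le> ?w' \<longleftrightarrow> s \<le> ?w" if "0 \<le> s" for s
    using le_coherency_index_ramp_iff[OF b] bend_ge_diff_ramp_other[OF A _ that indep]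
      bend_ge_of_diff_ramp[OF A that] that by blast
  show ?thesis
    using iff[of ?w'] iff[of ?w] coherency_index_ramp_nonneg[OF b] by force
qed

text \<open>Induction over \<open>I\<close>. The indices of all splits in \<open>J\<close> are
  carried along, so that the next split still satisfies \<open>bend_ge\<close> for the weight
  reduced so far.\<close>

lemma split_family_decomposition:
  assumes "finite J" "I \<subseteq> J"
    and a: "\<And>S. S \<in> J \<Longrightarrow> split_normal V (a S)"
    and indep: "\<And>S T k. S \<in> J \<Longrightarrow> T \<in> J \<Longrightarrow> S \<noteq> T \<Longrightarrow> a S \<noteq> k *\<^sub>R a T"
    and l: "\<And>S. S \<in> J \<Longrightarrow> 0 \<le> l S" "\<And>S. S \<in> J \<Longrightarrow> bend_ge V w (a S) (l S)"
  shows "envelope V w = envelope V (w - (\<Sum>S\<in>I. l S *\<^sub>R ramp V (a S))) +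
      (\<Sum>S\<in>I. envelope V (l S *\<^sub>R ramp V (a S))) \<and>
    (\<forall>T\<in>J. coherency_index V (w - (\<Sum>S\<in>I. l S *\<^sub>R ramp V (a S))) (ramp V (a T)) =
      coherency_index V w (ramp V (a T)) - (if T \<in> I then l T else 0))"
  using finite_subset[OF assms(2,1)] assms(2)
proof (induction I rule: finite_induct)
  case empty
  then show ?case
    by simp
next
  case (insert S I)
  let ?w = "w - (\<Sum>S\<in>I. l S *\<^sub>R ramp V (a S))"
  have S: "S \<in> J"
    using insert.prems by simp
  have IH: "envelope V w = envelope V ?w + (\<Sum>S\<in>I. envelope V (l S *\<^sub>R ramp V (a S)))"
    "\<And>T. T \<in> J \<Longrightarrow> coherency_index V ?w (ramp V (a T)) =
      coherency_index V w (ramp V (a T)) - (if T \<in> I then l T else 0)"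
    using insert by auto
  have bend: "bend_ge V ?w (a S) (l S)"
    using IH(2)[OF S] insert.hyps(2) l(2)[OF S]
    by (simp flip: le_coherency_index_ramp_iff[OF a[OF S] l(1)[OF S]])
  have w: "w - (\<Sum>S\<in>insert S I. l S *\<^sub>R ramp V (a S)) = ?w - l S *\<^sub>R ramp V (a S)"
    using insert.hyps by simp
  show ?case
    unfolding w
  proof (intro conjI ballI)
    show "envelope V w = envelope V (?w - l S *\<^sub>R ramp V (a S)) +
        (\<Sum>S\<in>insert S I. envelope V (l S *\<^sub>R ramp V (a S)))"
      using insert.hyps IH(1) bend_ge_imp_envelope_sum[OF bend l(1)[OF S]]
      by (simp add: add.assoc)
    fix T assume T: "T \<in> J"
    show "coherency_index V (?w - l S *\<^sub>R ramp V (a S)) (ramp V (a T)) =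
        coherency_index V w (ramp V (a T)) - (if T \<in> insert S I then l T else 0)"
    proof (cases "T = S")
      case True
      then show ?thesis
        using coherency_index_ramp_diff_same[OF a[OF S] bend l(1)[OF S]] IH(2)[OF T] insert.hyps(2) by simp
    next
      case False
      then show ?thesis
        using coherency_index_ramp_diff_other[OF a[OF T] bend l(1)[OF S] indep[OF S T]] IH(2)[OF T] by auto
    qed
  qed
qed

text \<open>Primeness concerns every normal of a split, whereas a given split weight fixes a single
  one.\<close>

lemma coherency_index_ramp_scaleR_eq_0:
  assumes a: "split_normal V a" and k: "k \<noteq> 0" and "coherency_index V w (ramp V a) = 0"
  shows "coherency_index V w (ramp V (k *\<^sub>R a)) = 0"
proof -
  let ?r = "coherency_index V w (ramp V (k *\<^sub>R a))"
  have 0: "0 \<le> ?r"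
    using coherency_index_ramp_nonneg split_normal_scaleR[OF a k] by blast
  then have "bend_ge V w (k *\<^sub>R a) ?r"
    using le_coherency_index_ramp_iff[OF split_normal_scaleR[OF a k]] by blast
  from bend_ge_scaleR[OF this, of "inverse k"] k have "bend_ge V w a (?r / \<bar>inverse k\<bar>)"
    by simp
  then have "?r / \<bar>inverse k\<bar> \<le> 0"
    using le_coherency_index_ramp_iff[OF a, of "?r / \<bar>inverse k\<bar>" w] 0 assms(3) by simp
  then show ?thesis
    using 0 k by (simp add: divide_le_0_iff)
qed

end

subsection \<open>Geometry of splits\<close>

locale polytope_config = vertex_config V y for V :: "real^'k^'n" and y +
  fixes P :: "(real^'k) set"
  assumes polytope_P: "polytope P" and vertex_matrix_P: "vertex_matrix P V"
begin

lemma vertices_P: "vertices P = range (\<lambda>i. row i V)"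
  using vertex_matrix_P by (auto simp: vertex_matrix_def bij_betw_def)

lemma convex_hull_vertices: "polytope C \<Longrightarrow> C = convex hull vertices C"
  for C :: "(real^'k) set"
  unfolding vertices_def
  by (intro Krein_Milman_Minkowski polytope_imp_compact polytope_imp_convex)

lemma P_subset:
  assumes "\<And>i. row i V \<in> C" "convex C"
  shows "P \<subseteq> C"
proof -
  have "convex hull vertices P \<subseteq> C"
    using assms by (intro hull_minimal) (auto simp: vertices_P)
  then show ?thesis
    by (simp flip: convex_hull_vertices[OF polytope_P])
qed

lemma row_in_P: "row i V \<in> P"
proof -
  have "row i V \<in> vertices P"
    by (simp add: vertices_P)
  then show ?thesis
    by (simp add: vertices_def extreme_point_of_def)
qed

lemma convex_P: "convex P"
  using polytope_P by (rule polytope_imp_convex)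

lemma inner_y:
  assumes "x \<in> P"
  shows "x \<bullet> y = 1"
proof -
  have "P \<subseteq> {x. y \<bullet> x = 1}"
    by (rule P_subset[OF _ convex_hyperplane]) (simp add: inner_commute[of y] row_inner_y)
  with assms show ?thesis
    by (auto simp: inner_commute)
qed

text \<open>An unordered pair, so that neither the scale nor the sign of a normal matters.\<close>

definition halfspace_pieces :: "real^'k \<Rightarrow> (real^'k) set set" where
  "halfspace_pieces c = {P \<inter> {x. 0 \<le> c \<bullet> x}, P \<inter> {x. c \<bullet> x \<le> 0}}"

lemma halfspace_pieces_scaleR:
  assumes "k \<noteq> 0"
  shows "halfspace_pieces (k *\<^sub>R c) = halfspace_pieces c"
proof (cases "0 < k")
  case True
  then have "{x. 0 \<le> k *\<^sub>R c \<bullet> x} = {x. 0 \<le> c \<bullet> x}" "{x. k *\<^sub>R c \<bullet> x \<le> 0} = {x. c \<bullet> x \<le> 0}"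
    by (auto simp: zero_le_mult_iff mult_le_0_iff)
  then show ?thesis
    by (simp only: halfspace_pieces_def)
next
  case False
  with assms have "{x. 0 \<le> k *\<^sub>R c \<bullet> x} = {x. c \<bullet> x \<le> 0}" "{x. k *\<^sub>R c \<bullet> x \<le> 0} = {x. 0 \<le> c \<bullet> x}"
    by (auto simp: zero_le_mult_iff mult_le_0_iff)
  then show ?thesis
    by (simp only: halfspace_pieces_def insert_commute)
qed

section \<open>Splits as complexes and their maximal cells\<close>

lemma splits_cells:
  assumes "S \<in> splits P"
  shows "finite S" "\<And>C. C \<in> S \<Longrightarrow> polytope C" "\<And>C. C \<in> S \<Longrightarrow> vertices C \<subseteq> vertices P"
    "\<And>C F. C \<in> S \<Longrightarrow> F face_of C \<Longrightarrow> F \<in> S"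
    "\<And>C D. C \<in> S \<Longrightarrow> D \<in> S \<Longrightarrow> C \<inter> D face_of C"
    "\<Union>S = P"
  using assms by (auto simp: splits_def subdivision_of_def polytopal_complex_def)

text \<open>Every cell is the convex hull of a subset of the finitely many vertices of
  \<open>P\<close>.\<close>

lemma finite_splits: "finite (splits P)"
proof (rule finite_subset)
  show "splits P \<subseteq> Pow ((\<lambda>X. convex hull X) ` Pow (vertices P))"
  proof (intro subsetI PowI)
    fix S C assume S: "S \<in> splits P" "C \<in> S"
    show "C \<in> (\<lambda>X. convex hull X) ` Pow (vertices P)"
      using convex_hull_vertices[OF splits_cells(2)[OF S]] splits_cells(3)[OF S] by (rule image_eqI[OF _ PowI])
  qed
qed (simp add: vertices_P)

lemma splits_subset_maximal_cell:
  assumes "S \<in> splits P" "C \<in> S"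
  obtains M where "M \<in> maximal_cells S" "C \<subseteq> M"
proof -
  obtain M where "M \<in> S" "C \<subseteq> M" "\<forall>D\<in>S. M \<subseteq> D \<longrightarrow> M = D"
    using finite_has_maximal2[OF splits_cells(1)[OF assms(1)] assms(2)] by blast
  then show ?thesis
    by (intro that[of M]) (auto simp: maximal_cells_def)
qed

text \<open>A cell meets a maximal cell containing it in a face, namely in itself.\<close>

lemma splits_eq:
  assumes "S \<in> splits P"
  shows "S = {F. \<exists>M\<in>maximal_cells S. F face_of M}"
proof (intro set_eqI iffI)
  fix C assume C: "C \<in> S"
  obtain M where M: "M \<in> maximal_cells S" "C \<subseteq> M"
    using assms C by (rule splits_subset_maximal_cell)
  then have "M \<inter> C face_of M"
    using splits_cells(5)[OF assms _ C] by (auto simp: maximal_cells_def)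
  then show "C \<in> {F. \<exists>M\<in>maximal_cells S. F face_of M}"
    using M by (auto simp: Int_absorb1)
next
  fix F assume "F \<in> {F. \<exists>M\<in>maximal_cells S. F face_of M}"
  then show "F \<in> S"
    using splits_cells(4)[OF assms] by (auto simp: maximal_cells_def)
qed

text \<open>The common face of the two cells is exposed in \<open>C\<close> by a functional, which may be taken linear
  because \<open>P\<close> lies in an affine hyperplane off the origin. Every segment from \<open>C\<close> to \<open>D\<close> meets
  the common face, so that the functional is negative on the rest of \<open>D\<close>.\<close>

lemma splits_maximal_cells:
  assumes S: "S \<in> splits P"
  obtains C D c where "maximal_cells S = {C, D}" "C \<in> S" "D \<in> S"
    "C = P \<inter> {x. 0 \<le> c \<bullet> x}" "D = P \<inter> {x. c \<bullet> x \<le> 0}"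
    "\<exists>p\<in>P. 0 < c \<bullet> p" "\<exists>p\<in>P. c \<bullet> p < 0"
proof -
  have "card (maximal_cells S) = 2"
    using S by (simp add: splits_def)
  then obtain C D where CD: "maximal_cells S = {C, D}" "C \<noteq> D"
    by (auto simp: card_2_iff)
  then have cells: "C \<in> S" "D \<in> S" and "\<not> C \<subseteq> D" "\<not> D \<subseteq> C"
    unfolding maximal_cells_def by blast+
  then obtain p q where p: "p \<in> C" "p \<notin> D" and q: "q \<in> D" "q \<notin> C"
    by blast
  have "P \<subseteq> C \<union> D"
  proof
    fix x assume "x \<in> P"
    then obtain F where "F \<in> S" "x \<in> F"
      using splits_cells(6)[OF S] by blast
    moreover from this(1) obtain M where "M \<in> maximal_cells S" "F \<subseteq> M"
      by (rule splits_subset_maximal_cell[OF S])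
    ultimately show "x \<in> C \<union> D"
      using CD(1) by auto
  qed
  then have P: "P = C \<union> D"
    using cells splits_cells(6)[OF S] by (intro equalityI) auto
  have "C \<inter> D exposed_face_of C"
    using splits_cells(5)[OF S cells] splits_cells(2)[OF S cells(1)]
    by (simp add: exposed_face_of_polyhedron polytope_imp_polyhedron)
  then obtain a b where ab: "C \<subseteq> {x. a \<bullet> x \<le> b}" "C \<inter> D = C \<inter> {x. a \<bullet> x = b}"
    by (auto simp: exposed_face_of_def)
  define c where "c = b *\<^sub>R y - a"
  have c: "c \<bullet> x = b - a \<bullet> x" if "x \<in> P" for x
    using inner_y[OF that] by (simp add: c_def inner_diff_left inner_commute[of y])
  have C_nonneg: "0 \<le> c \<bullet> x" if "x \<in> C" for x
    using that c[of x] ab(1) P by auto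
  have C_zero: "c \<bullet> x = 0 \<longleftrightarrow> x \<in> D" if "x \<in> C" for x
    using that c[of x] ab(2) P by auto
  have cp: "0 < c \<bullet> p"
    using C_nonneg[OF p(1)] C_zero[OF p(1)] p(2) by simp
  have closed: "closed C" "closed D"
    using splits_cells(2)[OF S] cells by (simp_all add: polytope_imp_closed)
  have D_neg: "c \<bullet> x < 0" if x: "x \<in> D" "x \<notin> C" for x
  proof -
    have seg: "closed_segment p x \<subseteq> C \<union> D"
      using closed_segment_subset[OF _ _ convex_P, of p x] p x by (simp add: P)
    have "C \<inter> D \<inter> closed_segment p x \<noteq> {}"
    proof
      assume "C \<inter> D \<inter> closed_segment p x = {}"
      from connected_closedD[OF connected_segment(1) this seg closed] show False
        using p(1) x(1) by auto
    qed
    then obtain r where "r \<in> C" "r \<in> D" "r \<in> closed_segment p x"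
      by blast
    then obtain u where r: "r \<in> C" "r \<in> D" "0 \<le> u" "u \<le> 1" "r = (1 - u) *\<^sub>R p + u *\<^sub>R x"
      unfolding in_segment by blast
    have "(1 - u) * (c \<bullet> p) + u * (c \<bullet> x) = 0"
      using C_zero[OF r(1)] r(2,5) by (simp add: inner_add_right)
    moreover have "u \<noteq> 1"
      using r x by auto
    then have "0 < (1 - u) * (c \<bullet> p)"
      using r(4) cp by simp
    ultimately have "u * (c \<bullet> x) < 0"
      by linarith
    then show ?thesis
      using r(3) by (simp add: mult_less_0_iff)
  qed
  have C_iff: "x \<in> C \<longleftrightarrow> 0 \<le> c \<bullet> x" and D_iff: "x \<in> D \<longleftrightarrow> c \<bullet> x \<le> 0" if "x \<in> P" for x
    using that C_nonneg[of x] C_zero[of x] D_neg[of x] unfolding P by fastforce+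
  show ?thesis
  proof (rule that[OF CD(1) cells])
    show "C = P \<inter> {x. 0 \<le> c \<bullet> x}" "D = P \<inter> {x. c \<bullet> x \<le> 0}"
      using C_iff D_iff by (auto simp: P)
    show "\<exists>p\<in>P. 0 < c \<bullet> p" "\<exists>p\<in>P. c \<bullet> p < 0"
      using cp p(1) D_neg[OF q] q(1) by (auto simp: P)
  qed
qed

text \<open>A segment crossing the hyperplane of \<open>c\<close> meets it in a point where
  \<open>a\<close> vanishes too, which makes the values of \<open>a\<close> and \<open>c\<close> at
  its ends proportional. Since the rows span, proportionality on \<open>P\<close> carries over to
  the vectors.\<close>

lemma split_normal_unique:
  assumes c: "\<exists>p\<in>P. 0 < c \<bullet> p" "\<exists>p\<in>P. c \<bullet> p < 0"
    and a: "a \<noteq> 0" "\<And>x. x \<in> P \<Longrightarrow> c \<bullet> x = 0 \<Longrightarrow> a \<bullet> x = 0"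
  obtains k where "k \<noteq> 0" "a = k *\<^sub>R c"
proof -
  obtain p q where p: "p \<in> P" "0 < c \<bullet> p" and q: "q \<in> P" "c \<bullet> q < 0"
    using c by blast
  have cross: "(a \<bullet> x) * (c \<bullet> z) = (a \<bullet> z) * (c \<bullet> x)"
    if x: "x \<in> P" "0 < c \<bullet> x" and z: "z \<in> P" "c \<bullet> z < 0" for x z
  proof -
    define s where "s = c \<bullet> x - c \<bullet> z"
    define r where "r = (- (c \<bullet> z) / s) *\<^sub>R x + ((c \<bullet> x) / s) *\<^sub>R z"
    have s: "0 < s"
      using x z by (simp add: s_def)
    have "- (c \<bullet> z) / s + (c \<bullet> x) / s = 1"
      using s by (simp add: s_def divide_simps)
    moreover have "0 \<le> - (c \<bullet> z) / s" "0 \<le> (c \<bullet> x) / s"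
      using x z s by (auto intro: divide_nonneg_pos divide_nonpos_pos)
    ultimately have "r \<in> P"
      using convex_P x(1) z(1) unfolding r_def convex_def by blast
    moreover have "c \<bullet> r = 0"
      by (simp add: r_def inner_diff_right)
    ultimately have "a \<bullet> r = 0"
      by (rule a(2))
    then show ?thesis
      using s by (simp add: r_def inner_diff_right field_simps)
  qed
  define k where "k = (a \<bullet> q) / (c \<bullet> q)"
  have k: "a \<bullet> x = k * (c \<bullet> x)" if "x \<in> P" for x
  proof -
    consider "0 < c \<bullet> x" | "c \<bullet> x = 0" | "c \<bullet> x < 0"
      by linarith
    then show ?thesis
    proof cases
      case 1
      then show ?thesis
        using cross[OF that 1 q] q by (simp add: k_def field_simps)
    next
      case 2
      then show ?thesis
        using a(2) that by simp
    next
      case 3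
      \<comment> \<open>\<open>x\<close> and \<open>q\<close> both lie on the negative side, so they
        are compared through \<open>p\<close>.\<close>
      have "(c \<bullet> p) * ((a \<bullet> q) * (c \<bullet> x)) = (c \<bullet> p) * ((a \<bullet> x) * (c \<bullet> q))"
        using cross[OF p that 3] cross[OF p q] by algebra
      then have "(a \<bullet> q) * (c \<bullet> x) = (a \<bullet> x) * (c \<bullet> q)"
        using p(2) by simp
      then show ?thesis
        using q by (simp add: k_def field_simps)
    qed
  qed
  have "a - k *\<^sub>R c = 0"
    by (rule rows_spanning) (use k row_in_P in \<open>simp add: inner_diff_right inner_commute[of "row _ V"]\<close>)
  then have "a = k *\<^sub>R c"
    by simp
  then show ?thesis
    using that a(1) by fastforce
qed

lemma row_cone_eq_scaleR_P:
  assumes "p \<in> row_cone V UNIV"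
  obtains s x where "0 \<le> s" "x \<in> P" "p = s *\<^sub>R x"
proof -
  obtain c where c: "\<forall>i. 0 \<le> c i" "p = (\<Sum>i\<in>UNIV. c i *\<^sub>R row i V)"
    using assms by (auto simp: row_cone_def)
  define s where "s = sum c UNIV"
  have s: "0 \<le> s"
    using c(1) by (simp add: s_def sum_nonneg)
  show ?thesis
  proof (cases "s = 0")
    case True
    then have "c i = 0" for i
      using c(1) by (simp add: s_def sum_nonneg_eq_0_iff)
    \<comment> \<open>With factor 0 any point of \<open>P\<close> serves.\<close>
    then show ?thesis
      using that[of 0 "row undefined V"] c(2) row_in_P by simp
  next
    case False
    have "(\<Sum>i\<in>UNIV. (c i / s) *\<^sub>R row i V) \<in> P"
      using c(1) s False row_in_P convex_P
      by (intro convex_sum) (auto simp: s_def simp flip: sum_divide_distrib)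
    moreover have "p = s *\<^sub>R (\<Sum>i\<in>UNIV. (c i / s) *\<^sub>R row i V)"
      using False by (simp add: c(2) scaleR_sum_right)
    ultimately show ?thesis
      using that s by blast
  qed
qed

text \<open>The common face \<open>C \<inter> D\<close> is itself a cell, so its vertices are
  vertices of \<open>P\<close>; this yields the last condition of \<open>split_normal\<close>. The
  sign of \<open>k\<close> records which cell is taken as \<open>Sp\<close>.\<close>

lemma splits_normal:
  assumes S: "S \<in> splits P"
  shows "\<exists>c. split_normal V c \<and> maximal_cells S = halfspace_pieces c \<and>
    (\<forall>u. split_weight V S u \<longrightarrow> (\<exists>k. k \<noteq> 0 \<and> u = ramp V (k *\<^sub>R c)))"
proof -
  obtain C D c where max: "maximal_cells S = {C, D}" and cells: "C \<in> S" "D \<in> S"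
    and C: "C = P \<inter> {x. 0 \<le> c \<bullet> x}" and D: "D = P \<inter> {x. c \<bullet> x \<le> 0}"
    and c: "\<exists>p\<in>P. 0 < c \<bullet> p" "\<exists>p\<in>P. c \<bullet> p < 0"
    by (rule splits_maximal_cells[OF S])
  have "\<exists>i. 0 < c \<bullet> row i V"
    using P_subset[of "{x. c \<bullet> x \<le> 0}"] c(1) by (force simp: convex_halfspace_le not_less)
  moreover have "\<exists>i. c \<bullet> row i V < 0"
    using P_subset[of "{x. c \<bullet> x \<ge> 0}"] c(2) by (force simp: convex_halfspace_ge not_less)
  moreover have "p \<in> row_cone V {i. c \<bullet> row i V = 0}" if p: "p \<in> row_cone V UNIV" "c \<bullet> p = 0" for p
  proof -
    obtain s x where x: "0 \<le> s" "x \<in> P" "p = s *\<^sub>R x"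
      by (rule row_cone_eq_scaleR_P[OF p(1)])
    show ?thesis
    proof (cases "s = 0")
      case True
      then show ?thesis
        using x(3) by (auto simp: row_cone_def intro!: exI[of _ "\<lambda>_. 0"])
    next
      case False
      then have "c \<bullet> x = 0"
        using p(2) x(3) by simp
      have "C \<inter> D \<in> S"
        by (rule splits_cells(4)[OF S cells(1) splits_cells(5)[OF S cells]])
      then have F: "C \<inter> D = convex hull vertices (C \<inter> D)" "vertices (C \<inter> D) \<subseteq> range (\<lambda>i. row i V)"
        using convex_hull_vertices[OF splits_cells(2)[OF S]] splits_cells(3)[OF S] vertices_P by simp_all
      have "vertices (C \<inter> D) \<subseteq> C \<inter> D"
        by (auto simp: vertices_def extreme_point_of_def)
      then have "vertices (C \<inter> D) \<subseteq> row_cone V {i. c \<bullet> row i V = 0}"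
      proof (intro subsetI)
        fix v assume v: "v \<in> vertices (C \<inter> D)" and sub: "vertices (C \<inter> D) \<subseteq> C \<inter> D"
        then obtain i where "v = row i V"
          using F(2) by blast
        moreover have "v \<in> C \<inter> D"
          using v sub by blast
        then have "c \<bullet> v = 0"
          by (simp add: C D)
        ultimately show "v \<in> row_cone V {i. c \<bullet> row i V = 0}"
          by (simp add: row_cone_row)
      qed
      then have "convex hull vertices (C \<inter> D) \<subseteq> row_cone V {i. c \<bullet> row i V = 0}"
        using convex_row_cone by (rule hull_minimal)
      then have "C \<inter> D \<subseteq> row_cone V {i. c \<bullet> row i V = 0}"
        by (simp flip: F(1))
      moreover have "x \<in> C \<inter> D"
        using x(2) \<open>c \<bullet> x = 0\<close> C D by simp
      ultimately show ?thesis
        unfolding x(3) using x(1) by (intro row_cone_scaleR) auto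
    qed
  qed
  ultimately have "split_normal V c"
    by (auto simp: split_normal_def)
  moreover have "\<exists>k. k \<noteq> 0 \<and> u = ramp V (k *\<^sub>R c)" if u: "split_weight V S u" for u
  proof -
    obtain Sp Sm a where Sp: "maximal_cells S = {Sp, Sm}"
      and a: "a \<noteq> 0" "\<forall>x\<in>span (Sp \<inter> Sm). a \<bullet> x = 0"
      and u: "u = (\<chi> i. if row i V \<in> Sp then \<bar>a \<bullet> row i V\<bar> else 0)"
      using u unfolding split_weight_def by blast
    have Sp_cases: "Sp = C \<and> Sm = D \<or> Sp = D \<and> Sm = C"
      using max Sp by (metis doubleton_eq_iff)
    have a0: "a \<bullet> x = 0" if "x \<in> P" "c \<bullet> x = 0" for x
    proof -
      have "x \<in> Sp \<inter> Sm"
        using that C D Sp_cases by auto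
      then show ?thesis
        using a(2) span_base by blast
    qed
    have max_mult: "max 0 (\<bar>k\<bar> * r) = \<bar>k\<bar> * max 0 r" "max 0 (- (\<bar>k\<bar> * r)) = \<bar>k\<bar> * max 0 (- r)"
      for k r :: real
      using max_mult_distrib_left[of "\<bar>k\<bar>" 0 "- r"] by (simp_all add: max_mult_distrib_left)
    then obtain k where k: "k \<noteq> 0" "a = k *\<^sub>R c"
      using split_normal_unique[OF c a(1) a0] by metis
    from Sp_cases show ?thesis
    proof
      assume "Sp = C \<and> Sm = D"
      then have "u = ramp V (\<bar>k\<bar> *\<^sub>R c)"
        using row_in_P by (simp add: vec_eq_iff u k(2) C abs_mult max_mult)
      then show ?thesis
        using k(1) by (intro exI[of _ "\<bar>k\<bar>"]) simp
    next
      assume "Sp = D \<and> Sm = C"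
      then have "u = ramp V ((- \<bar>k\<bar>) *\<^sub>R c)"
        using row_in_P by (simp add: vec_eq_iff u k(2) D abs_mult max_mult)
      then show ?thesis
        using k(1) by (intro exI[of _ "- \<bar>k\<bar>"]) simp
    qed
  qed
  ultimately show ?thesis
    using max C D by (intro exI[of _ c]) (simp add: halfspace_pieces_def)
qed

end

text \<open>The all-ones vector supplies \<open>y\<close>. A nonzero \<open>d\<close> orthogonal to
  all rows would put \<open>P\<close> and the origin in a hyperplane, yet the origin is off the
  affine hull of \<open>P\<close> and raises the dimension to that of the whole space.\<close>

lemma polytope_configI:
  fixes P :: "(real^'k) set" and V :: "real^'k^'n"
  assumes P: "polytope P" "aff_dim P = int CARD('k) - 1" "vertex_matrix P V"
    and one: "(\<chi> i. 1) \<in> span (columns V)"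
  obtains y where "polytope_config V y P"
proof -
  have vert: "vertices P = range (\<lambda>i. row i V)"
    using P(3) by (auto simp: vertex_matrix_def bij_betw_def)
  have "P = convex hull vertices P"
    unfolding vertices_def using P(1)
    by (intro Krein_Milman_Minkowski polytope_imp_compact polytope_imp_convex)
  then have hull: "P = convex hull (range (\<lambda>i. row i V))"
    by (simp add: vert)
  have "span (columns V) = (*v) V ` span (range (\<lambda>i. axis i 1))"
    by (simp add: columns_image_basis linear_span_image)
  then obtain y where y: "V *v y = (\<chi> i. 1)"
    using one by auto
  have row_y: "row i V \<bullet> y = 1" for i
    using arg_cong[OF y, of "\<lambda>v. v $ i"] by (simp add: matrix_vector_mult_def row_def inner_vec_def)
  have "d = 0" if d: "\<And>i. row i V \<bullet> d = 0" for d
  proof (rule ccontr)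
    assume "d \<noteq> 0"
    have "P \<subseteq> {x. y \<bullet> x = 1}"
      unfolding hull by (rule hull_minimal[where S = convex, OF _ convex_hyperplane]) (auto simp: row_y inner_commute[of y])
    then have "affine hull P \<subseteq> {x. y \<bullet> x = 1}"
      by (rule hull_minimal) (rule affine_hyperplane)
    then have "0 \<notin> affine hull P"
      by auto
    then have "aff_dim (insert 0 P) = int CARD('k)"
      by (simp add: aff_dim_insert P(2))
    moreover have "P \<subseteq> {x. d \<bullet> x = 0}"
      unfolding hull by (rule hull_minimal[where S = convex, OF _ convex_hyperplane]) (auto simp: d inner_commute[of d])
    then have "aff_dim (insert 0 P) \<le> aff_dim {x. d \<bullet> x = 0}"
      by (intro aff_dim_subset) auto
    ultimately show False
      using \<open>d \<noteq> 0\<close> by (simp add: aff_dim_hyperplane)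
  qed
  then have "polytope_config V y P"
    using row_y P by unfold_locales auto
  then show ?thesis
    by (rule that)
qed

lemma coherent_option:
  assumes "finite A"
  shows "coherent V (insert None (Some ` A)) (case_option w0 u) \<longleftrightarrow>
    envelope V w0 + (\<Sum>S\<in>A. envelope V (u S)) = envelope V (w0 + (\<Sum>S\<in>A. u S))"
  using assms by (simp add: coherent_def sum.reindex)

subsection \<open>The split decomposition\<close>

theorem theorem3p10:
  fixes P :: "(real^'k) set"
    and V :: "real^'k^'n"
    and wS :: "(real^'k) set set \<Rightarrow> real^'n"
    and w :: "real^'n"
  assumes "polytope P"
    and "aff_dim P = int CARD('k) - 1"
    and "vertex_matrix P V"
    and "(\<chi> i. 1) \<in> span (columns V)"
    and "\<And>S. S \<in> splits P \<Longrightarrow> split_weight V S (wS S)"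
  shows "\<exists>w0 lam.
      split_prime P V w0 \<and> split_decomposition P V wS w w0 lam \<and>
      (\<forall>w0' lam'. split_prime P V w0' \<and> split_decomposition P V wS w w0' lam' \<longrightarrow>
         w0' = w0 \<and> (\<forall>S\<in>splits P. lam' S = lam S))"
proof -
  obtain y where "polytope_config V y P"
    by (rule polytope_configI[OF assms(1-4)])
  then interpret polytope_config V y P .
  have "\<forall>S\<in>splits P. \<exists>c. split_normal V c \<and> maximal_cells S = halfspace_pieces c \<and>
      (\<forall>u. split_weight V S u \<longrightarrow> (\<exists>k. k \<noteq> 0 \<and> u = ramp V (k *\<^sub>R c)))"
    using splits_normal by (rule ballI)
  from bchoice[OF this] obtain c where "\<forall>S\<in>splits P. split_normal V (c S) \<and>
      maximal_cells S = halfspace_pieces (c S) \<and>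
      (\<forall>u. split_weight V S u \<longrightarrow> (\<exists>k. k \<noteq> 0 \<and> u = ramp V (k *\<^sub>R c S)))" ..
  then have c: "\<And>S. S \<in> splits P \<Longrightarrow> split_normal V (c S)"
    "\<And>S. S \<in> splits P \<Longrightarrow> maximal_cells S = halfspace_pieces (c S)"
    "\<And>S u. S \<in> splits P \<Longrightarrow> split_weight V S u \<Longrightarrow> \<exists>k. k \<noteq> 0 \<and> u = ramp V (k *\<^sub>R c S)"
    by simp_all
  have "\<forall>S\<in>splits P. \<exists>k. k \<noteq> 0 \<and> wS S = ramp V (k *\<^sub>R c S)"
    using c(3)[OF _ assms(5)] by simp
  from bchoice[OF this] obtain k where "\<forall>S\<in>splits P. k S \<noteq> 0 \<and> wS S = ramp V (k S *\<^sub>R c S)" ..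
  then have k: "\<And>S. S \<in> splits P \<Longrightarrow> k S \<noteq> 0"
    "\<And>S. S \<in> splits P \<Longrightarrow> wS S = ramp V (k S *\<^sub>R c S)"
    by simp_all
  \<comment> \<open>The normal is rescaled so that the given split weight is exactly its
    ramp.\<close>
  define a where "a S = k S *\<^sub>R c S" for S
  have wS: "wS S = ramp V (a S)" if "S \<in> splits P" for S
    using k(2)[OF that] by (simp add: a_def)
  have a: "split_normal V (a S)" if "S \<in> splits P" for S
    using c(1) k(1) that by (simp add: a_def split_normal_scaleR)
  \<comment> \<open>Proportional normals cut \<open>P\<close> into the same two cells, and these
    determine the split.\<close>
  have indep: "a S \<noteq> r *\<^sub>R a T" if ST: "S \<in> splits P" "T \<in> splits P" "S \<noteq> T" for S T r
  proof
    assume eq: "a S = r *\<^sub>R a T"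
    have "a S \<noteq> 0"
      using a[OF ST(1)] by (auto simp: split_normal_def)
    then have "r \<noteq> 0"
      using eq by auto
    have "halfspace_pieces (c S) = halfspace_pieces (a S)" "halfspace_pieces (a T) = halfspace_pieces (c T)"
      using k(1) ST by (simp_all add: a_def halfspace_pieces_scaleR)
    then have cells: "maximal_cells S = maximal_cells T"
      using c(2)[OF ST(1)] c(2)[OF ST(2)] halfspace_pieces_scaleR[OF \<open>r \<noteq> 0\<close>, of "a T"] eq by simp
    have "S = {F. \<exists>M\<in>maximal_cells S. F face_of M}"
      by (rule splits_eq[OF ST(1)])
    also have "\<dots> = {F. \<exists>M\<in>maximal_cells T. F face_of M}"
      by (simp only: cells)
    also have "\<dots> = T"
      by (rule splits_eq[OF ST(2), symmetric])
    finally show False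
      using ST(3) by contradiction
  qed
  have prime: "split_prime P V u \<longleftrightarrow> (\<forall>S\<in>splits P. coherency_index V u (ramp V (a S)) = 0)" for u
  proof
    assume "split_prime P V u"
    then show "\<forall>S\<in>splits P. coherency_index V u (ramp V (a S)) = 0"
      using assms(5) unfolding split_prime_def by (simp flip: wS)
  next
    assume *: "\<forall>S\<in>splits P. coherency_index V u (ramp V (a S)) = 0"
    show "split_prime P V u"
      unfolding split_prime_def
    proof (intro ballI allI impI)
      fix S v assume S: "S \<in> splits P" "split_weight V S v"
      then obtain r where r: "r \<noteq> 0" "v = ramp V (r *\<^sub>R c S)"
        using c(3)[OF S] by blast
      have "r *\<^sub>R c S = (r / k S) *\<^sub>R a S"
        using k(1) S by (simp add: a_def)
      then show "coherency_index V u v = 0"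
        using coherency_index_ramp_scaleR_eq_0[OF a[OF S(1)], of "r / k S" u] * S(1) r k(1) by simp
    qed
  qed
  have sum_wS: "(\<Sum>S\<in>splits P. l S *\<^sub>R wS S) = (\<Sum>S\<in>splits P. l S *\<^sub>R ramp V (a S))" for l
    by (intro sum.cong) (simp_all add: wS)
  have sum_env: "(\<Sum>S\<in>splits P. envelope V (l S *\<^sub>R wS S)) =
      (\<Sum>S\<in>splits P. envelope V (l S *\<^sub>R ramp V (a S)))" for l
    by (intro sum.cong) (simp_all add: wS)
  have dec: "split_decomposition P V wS w w0 l \<longleftrightarrow>
      (\<forall>S\<in>splits P. 0 \<le> l S) \<and> w = w0 + (\<Sum>S\<in>splits P. l S *\<^sub>R ramp V (a S)) \<and>
      envelope V w = envelope V w0 + (\<Sum>S\<in>splits P. envelope V (l S *\<^sub>R ramp V (a S)))" for w0 l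
    unfolding split_decomposition_def coherent_option[OF finite_splits] sum_wS sum_env by auto
  \<comment> \<open>The largest coefficients compatible with \<open>bend_ge\<close>.\<close>
  define lam where "lam S = coherency_index V w (ramp V (a S))" for S
  define w0 where "w0 = w - (\<Sum>S\<in>splits P. lam S *\<^sub>R ramp V (a S))"
  have lam: "0 \<le> lam S" "bend_ge V w (a S) (lam S)" if "S \<in> splits P" for S
    using coherency_index_ramp_nonneg[OF a[OF that]] le_coherency_index_ramp_iff[OF a[OF that], of "lam S" w]
    by (simp_all add: lam_def)
  have family: "envelope V w = envelope V (w - (\<Sum>S\<in>splits P. l S *\<^sub>R ramp V (a S))) +
        (\<Sum>S\<in>splits P. envelope V (l S *\<^sub>R ramp V (a S)))"
      "\<And>T. T \<in> splits P \<Longrightarrow>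
        coherency_index V (w - (\<Sum>S\<in>splits P. l S *\<^sub>R ramp V (a S))) (ramp V (a T)) = lam T - l T"
    if l: "\<And>S. S \<in> splits P \<Longrightarrow> 0 \<le> l S" "\<And>S. S \<in> splits P \<Longrightarrow> bend_ge V w (a S) (l S)" for l
    using split_family_decomposition[where J = "splits P" and I = "splits P" and a = a and l = l and w = w,
        OF finite_splits subset_refl a indep l]
    by (simp_all add: lam_def)
  have fam: "envelope V w = envelope V w0 + (\<Sum>S\<in>splits P. envelope V (lam S *\<^sub>R ramp V (a S)))"
    "\<forall>S\<in>splits P. coherency_index V w0 (ramp V (a S)) = 0"
    using family[OF lam] by (simp_all add: w0_def)
  have exist: "split_prime P V w0" "split_decomposition P V wS w w0 lam"
    using fam lam(1) by (simp_all add: prime dec w0_def)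
  have unique: "w0' = w0 \<and> (\<forall>S\<in>splits P. l S = lam S)"
    if "split_prime P V w0'" "split_decomposition P V wS w w0' l" for w0' l
  proof -
    have l: "\<And>S. S \<in> splits P \<Longrightarrow> 0 \<le> l S" and w: "w = w0' + (\<Sum>S\<in>splits P. l S *\<^sub>R ramp V (a S))"
      and env: "envelope V w = envelope V w0' + (\<Sum>S\<in>splits P. envelope V (l S *\<^sub>R ramp V (a S)))"
      using that(2) unfolding dec by auto
    \<comment> \<open>Collecting the summands other than that of \<open>S\<close> in one envelope
      shows that \<open>l S *\<^sub>R ramp V (a S)\<close> alone splits off coherently.\<close>
    have bend: "bend_ge V w (a S) (l S)" if S: "S \<in> splits P" for S
    proof (rule envelope_sum_imp_bend_ge[OF a[OF S] l[OF S]])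
      let ?R = "splits P - {S}"
      have "envelope V w = (envelope V w0' + (\<Sum>T\<in>?R. envelope V (l T *\<^sub>R ramp V (a T)))) +
          envelope V (l S *\<^sub>R ramp V (a S))"
        unfolding env sum.remove[OF finite_splits S] by (simp add: ac_simps)
      also have "\<dots> \<subseteq> envelope V (w - l S *\<^sub>R ramp V (a S)) + envelope V (l S *\<^sub>R ramp V (a S))"
      proof (rule set_plus_mono2[OF _ subset_refl])
        have "w - l S *\<^sub>R ramp V (a S) = w0' + (\<Sum>T\<in>?R. l T *\<^sub>R ramp V (a T))"
          using w unfolding sum.remove[OF finite_splits S] by simp
        then show "envelope V w0' + (\<Sum>T\<in>?R. envelope V (l T *\<^sub>R ramp V (a T))) \<subseteq>
            envelope V (w - l S *\<^sub>R ramp V (a S))"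
          using sum_envelope_subset[of ?R V "\<lambda>T. l T *\<^sub>R ramp V (a T)"] finite_splits
          by (auto simp: set_plus_def dest!: subsetD intro!: envelope_add)
      qed
      finally show "envelope V w \<subseteq> envelope V (w - l S *\<^sub>R ramp V (a S)) + envelope V (l S *\<^sub>R ramp V (a S))" .
    qed
    have "w - (\<Sum>S\<in>splits P. l S *\<^sub>R ramp V (a S)) = w0'"
      using w by simp
    \<comment> \<open>The competing coefficients leave the indices \<open>lam S - l S\<close>, which
      primeness of \<open>w0'\<close> forces to be 0.\<close>
    then have "\<forall>S\<in>splits P. coherency_index V w0' (ramp V (a S)) = lam S - l S"
      using family(2)[OF l bend] by simp
    then have *: "\<forall>S\<in>splits P. l S = lam S"
      using that(1) unfolding prime by simp
    then have "w0' = w0"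
      using w by (simp add: w0_def)
    with * show ?thesis by blast
  qed
  show ?thesis
  proof (intro exI[of _ w0] exI[of _ lam] conjI exist)
    show "\<forall>w0' l. split_prime P V w0' \<and> split_decomposition P V wS w w0' l \<longrightarrow>
        w0' = w0 \<and> (\<forall>S\<in>splits P. l S = lam S)"
      by (intro allI impI, elim conjE) (rule unique)
  qed
qed

end
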